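(* Let $A,B\subset\mathbb{R}^n$ be topological submanifolds with $\dim A=k$, $\dim B=l$, and let $p\in A\cap B$. Let $i_A\colon A\to\mathbb{R}^n$ and $i_B\colon B\to\mathbb{R}^n$ be the inclusion embeddings. Let $U\subset\mathbb{R}^n$ be a neighborhood of $p$ and $\phi\colon U\to\mathbb{R}^n$ a homeomorphism with $\phi(p)=0$ and $\phi(A\cap U)=\mathbb{R}^k\times\{0\}^{n-k}$. Let $V_A\subset A$ be a neighborhood of $p$ in $A$ and $V_B\subset B$ a neighborhood of $p$ in $B$ such that $\mathrm{Cl}(V_A)\subset U$ and $\mathrm{Cl}(V_B)\subset U$. Fix $\nu>0$, put $$J=[-1,1]^n,\qquad J_A=[-1-\nu,1+\nu]^k\times\{0\}^{n-k},$$ and assume that $J_A\subset\phi(V_A)$. Suppose that there exists a continuous mapping $f\colon D^{n-k}\to V_B$ such that $$\phi(f(D^{n-k}))\subset J,\qquad \phi(f(S^{n-k-1}))\subset J\setminus J_A,$$ and the homomorphism of reduced homology groups induced by the restriction of $\phi\circ f$ to $S^{n-k-1}$, $$(\phi\circ f)_*\colon \widetilde{H}_{n-k-1}(S^{n-k-1})\to\widetilde{H}_{n-k-1}(J\setminus J_A),$$ is nontrivial. Then there exists a number $\delta>0$ such that the intersection $i_A(V_A)\cap i_B(V_B)$ is $\delta$-essential.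
   Context: The space $\mathbb{R}^n$ carries the norm $|(a_1,\dots,a_n)|=\max\{|a_1|,\dots,|a_n|\}$ and the metric $\mathrm{dist}(x,y)=|x-y|$. $D^m=[-1,1]^m$ and $S^{m-1}=\partial D^m$. $\mathrm{Cl}$ denotes closure, and $\widetilde{H}_j$ is the $j$-th reduced homology group with integer coefficients. The set $J\setminus J_A$ is homotopy equivalent to $S^{n-k-1}$, so $\widetilde{H}_{n-k-1}(J\setminus J_A)\cong\mathbb{Z}$ (for $k=n$ one uses $\widetilde{H}_{-1}(\varnothing)=\mathbb{Z}$, with $S^{-1}=\varnothing$ and $D^0$ a point). Manifolds are Hausdorff and paracompact. Topological submanifolds are locally flat, i.e. they admit near each of their points a chart such as $\phi$ above. For continuous mappings $f_1,f_2\colon X\to\mathbb{R}^n$ of a topological space $X$, put $|f_1,f_2|_{C^0}=\sup_{x\in X}\mathrm{dist}(f_1(x),f_2(x))$. Let $X,Y$ be topological spaces, $h_1\colon X\to\mathbb{R}^n$ and $h_2\colon Y\to\mathbb{R}^n$ continuous, $U_X\subset X$ and $U_Y\subset Y$ arbitrary subsets, and $\delta>0$. The intersection $h_1(U_X)\cap h_2(U_Y)$ is called $\delta$-essential if $\widetilde{h_1}(U_X)\cap\widetilde{h_2}(U_Y)\neq\varnothing$ for any continuous mappings $\widetilde{h_1}\colon X\to\mathbb{R}^n$ and $\widetilde{h_2}\colon Y\to\mathbb{R}^n$ such that $|h_1,\widetilde{h_1}|_{C^0}\le\delta$ and $|h_2,\widetilde{h_2}|_{C^0}\le\delta$. *)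

theory Defs
  imports "HOL-Homology.Homology" "HOL-Library.Extended_Nonnegative_Real"
begin

text \<open>
  The space of real \<open>n\<close>-tuples is the library's \<^const>\<open>Euclidean_space\<close> \<open>n\<close>: its points are the
  sequences vanishing from index \<open>n\<close> on. For \<open>k \<le> n\<close>, the subset \<open>topspace (Euclidean_space k)\<close> of
  it is therefore literally the coordinate plane \<open>\<real>\<^sup>k \<times> {0}\<^sup>n\<^sup>-\<^sup>k\<close>, and \<open>cube k r\<close> is
  \<open>[-r,r]\<^sup>k \<times> {0}\<^sup>n\<^sup>-\<^sup>k\<close>.
\<close>

definition cube :: "nat \<Rightarrow> real \<Rightarrow> (nat \<Rightarrow> real) set" where
  "cube m r = {x \<in> topspace (Euclidean_space m). \<forall>i<m. x i \<in> {-r..r}}"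

definition cube_sphere :: "nat \<Rightarrow> (nat \<Rightarrow> real) set" where
  "cube_sphere m = (Euclidean_space m) frontier_of (cube m 1)"

text \<open>The inserted \<open>0\<close> only matters for \<open>n = 0\<close>.\<close>

definition max_norm :: "nat \<Rightarrow> (nat \<Rightarrow> real) \<Rightarrow> real" where
  "max_norm n x = Max (insert 0 ((\<lambda>i. \<bar>x i\<bar>) ` {..<n}))"

definition max_dist :: "nat \<Rightarrow> (nat \<Rightarrow> real) \<Rightarrow> (nat \<Rightarrow> real) \<Rightarrow> real" where
  "max_dist n x y = max_norm n (\<lambda>i. x i - y i)"

definition C0_dist ::
  "nat \<Rightarrow> 'a topology \<Rightarrow> ('a \<Rightarrow> nat \<Rightarrow> real) \<Rightarrow> ('a \<Rightarrow> nat \<Rightarrow> real) \<Rightarrow> ennreal" where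
  "C0_dist n X f g = (SUP x\<in>topspace X. ennreal (max_dist n (f x) (g x)))"

definition essential_intersection ::
  "nat \<Rightarrow> real \<Rightarrow> 'a topology \<Rightarrow> 'b topology \<Rightarrow> ('a \<Rightarrow> nat \<Rightarrow> real) \<Rightarrow> ('b \<Rightarrow> nat \<Rightarrow> real)
    \<Rightarrow> 'a set \<Rightarrow> 'b set \<Rightarrow> bool" where
  "essential_intersection n \<delta> X Y h1 h2 UX UY \<longleftrightarrow>
    (\<forall>g1 g2. continuous_map X (Euclidean_space n) g1 \<and> continuous_map Y (Euclidean_space n) g2 \<and>
       C0_dist n X h1 g1 \<le> ennreal \<delta> \<and> C0_dist n Y h2 g2 \<le> ennreal \<delta>
       \<longrightarrow> g1 ` UX \<inter> g2 ` UY \<noteq> {})"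

text \<open>Neighbourhoods are not required to be open.\<close>

definition neighbourhood :: "'a topology \<Rightarrow> 'a \<Rightarrow> 'a set \<Rightarrow> bool" where
  "neighbourhood X p N \<longleftrightarrow> N \<subseteq> topspace X \<and> p \<in> X interior_of N"

definition flat_chart ::
  "nat \<Rightarrow> nat \<Rightarrow> (nat \<Rightarrow> real) set \<Rightarrow> (nat \<Rightarrow> real) \<Rightarrow> (nat \<Rightarrow> real) set
    \<Rightarrow> ((nat \<Rightarrow> real) \<Rightarrow> nat \<Rightarrow> real) \<Rightarrow> bool" where
  "flat_chart n k A p U \<phi> \<longleftrightarrow>
     neighbourhood (Euclidean_space n) p U \<and>
     homeomorphic_map (subtopology (Euclidean_space n) U) (Euclidean_space n) \<phi> \<and>
     \<phi> p = (\<lambda>i. 0) \<and>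
     \<phi> ` (A \<inter> U) = topspace (Euclidean_space k)"

text \<open>Subspaces of a Euclidean space are automatically Hausdorff and paracompact.\<close>

definition topological_submanifold :: "nat \<Rightarrow> nat \<Rightarrow> (nat \<Rightarrow> real) set \<Rightarrow> bool" where
  "topological_submanifold n k A \<longleftrightarrow>
     k \<le> n \<and> A \<subseteq> topspace (Euclidean_space n) \<and> (\<forall>a\<in>A. \<exists>U \<phi>. flat_chart n k A a U \<phi>)"

text \<open>
  The library's \<^const>\<open>reduced_homology_group\<close> is trivial in all negative degrees. Its extension
  below to degree \<open>-1\<close> is the homology of the augmented singular chain complex: the chains of
  degree \<open>-1\<close> are the integer multiples of the unique \<open>-1\<close>-simplex (the map with empty domain,
  which as an extensional function is constantly \<^const>\<open>undefined\<close>), the boundary from degree \<open>0\<close>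
  is the augmentation, and every chain map sends the \<open>-1\<close>-simplex to the \<open>-1\<close>-simplex. So the
  empty space has the integers as its reduced homology in degree \<open>-1\<close>. The map
  \<open>augmentation\<close> serves both as that boundary and as the chain map in degree \<open>-1\<close>.
\<close>

definition augmentation :: "'a chain \<Rightarrow> 'b chain" where
  "augmentation = frag_extend (\<lambda>_. frag_of (\<lambda>_. undefined))"

definition aug_chain_group :: "'a chain monoid" where
  "aug_chain_group = free_Abelian_group {\<lambda>_. undefined}"

definition aug_boundaries :: "'a topology \<Rightarrow> 'a chain set" where
  "aug_boundaries X = augmentation ` singular_chain_set 0 X"

definition aug_homology_group :: "int \<Rightarrow> 'a topology \<Rightarrow> 'a chain set monoid" where
  "aug_homology_group p X =
     (if p = -1 then aug_chain_group Mod aug_boundaries X else reduced_homology_group p X)"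

definition aug_hom_induced ::
  "int \<Rightarrow> 'a topology \<Rightarrow> 'b topology \<Rightarrow> ('a \<Rightarrow> 'b) \<Rightarrow> 'a chain set \<Rightarrow> 'b chain set" where
  "aug_hom_induced p X Y f =
     (if p = -1 then (\<lambda>C. \<Union>c\<in>C. aug_boundaries Y #>\<^bsub>aug_chain_group\<^esub> augmentation c)
      else hom_induced p X {} Y {} f)"


lemma augmentation_add: "augmentation (a + b) = augmentation a + augmentation b"
  by (simp add: augmentation_def frag_extend_add)

lemma augmentation_minus: "augmentation (- a) = - augmentation a"
  by (simp add: augmentation_def frag_extend_minus)

lemma augmentation_0 [simp]: "augmentation 0 = 0"
  by (simp add: augmentation_def)

lemma augmentation_augmentation:
  "augmentation (augmentation c :: 'b chain) = (augmentation c :: 'c chain)"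
  using frag_extend_compose [of _ "\<lambda>_ _. undefined" c] by (simp add: augmentation_def o_def)

lemma augmentation_in_carrier: "augmentation c \<in> carrier aug_chain_group"
  unfolding augmentation_def aug_chain_group_def free_Abelian_group_def
  by (auto dest: subsetD [OF keys_frag_extend])

lemma augmentation_chain_map: "augmentation (chain_map p f c) = augmentation c"
  unfolding augmentation_def chain_map_def frag_extend_compose by (simp add: o_def)

lemma comm_group_aug_chain_group: "comm_group aug_chain_group"
  by (simp add: aug_chain_group_def abelian_free_Abelian_group)

lemma subgroup_aug_boundaries: "subgroup (aug_boundaries X) aug_chain_group"
proof (rule group.subgroupI)
  show "group (aug_chain_group :: 'a chain monoid)"
    by (simp add: aug_chain_group_def)
  show "aug_boundaries X \<subseteq> carrier aug_chain_group"
    by (auto simp: aug_boundaries_def augmentation_in_carrier)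
  show "aug_boundaries X \<noteq> {}"
    by (auto simp: aug_boundaries_def intro: exI [of _ 0])
next
  fix a assume a: "a \<in> aug_boundaries X"
  then obtain c where c: "a = augmentation c" "singular_chain 0 X c"
    by (auto simp: aug_boundaries_def)
  have "inv\<^bsub>aug_chain_group\<^esub> a = - a"
    using augmentation_in_carrier [of c] c(1)
    unfolding aug_chain_group_def by (metis carrier_free_Abelian_group_iff inv_free_Abelian_group)
  also have "\<dots> = augmentation (- c)"
    by (simp add: c(1) augmentation_minus)
  finally show "inv\<^bsub>aug_chain_group\<^esub> a \<in> aug_boundaries X"
    using c by (auto simp: aug_boundaries_def singular_chain_minus)
next
  fix a b assume "a \<in> aug_boundaries X" "b \<in> aug_boundaries X"
  then obtain c d where c: "a = augmentation c" "singular_chain 0 X c"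
     "b = augmentation d" "singular_chain 0 X d"
    by (auto simp: aug_boundaries_def)
  then have "a \<otimes>\<^bsub>aug_chain_group\<^esub> b = augmentation (c + d)"
    by (simp add: aug_chain_group_def augmentation_add)
  then show "a \<otimes>\<^bsub>aug_chain_group\<^esub> b \<in> aug_boundaries X"
    using c by (auto simp: aug_boundaries_def singular_chain_add)
qed

lemma normal_aug_boundaries: "aug_boundaries X \<lhd> aug_chain_group"
  by (simp add: comm_group.subgroup_imp_normal comm_group_aug_chain_group subgroup_aug_boundaries)

lemma group_aug_homology_group: "group (aug_homology_group p X)"
  by (simp add: aug_homology_group_def normal.factorgroup_is_group normal_aug_boundaries)

lemma aug_homology_group_empty_iso:
  fixes X :: "'a topology"
  assumes "topspace X = {}"
  shows "aug_homology_group (-1) X \<cong> integer_group"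
proof -
  let ?e = "\<lambda>_. undefined :: 'a"
  let ?h = "\<lambda>c :: 'a chain. poly_mapping.lookup c ?e"
  have h: "group_hom aug_chain_group integer_group ?h"
    by (auto simp: group_hom_def group_hom_axioms_def hom_def aug_chain_group_def lookup_add)
  have "singular_chain 0 X c \<longleftrightarrow> c = 0" for c
    by (metis assms singular_chain_0 singular_chain_empty)
  then have "aug_boundaries X = {0}"
    by (auto simp: aug_boundaries_def)
  also have "\<dots> = kernel aug_chain_group integer_group ?h"
  proof -
    have "c = 0" if "Poly_Mapping.keys c \<subseteq> {?e}" "?h c = 0" for c
      using that by (metis in_keys_iff keys_eq_empty subset_singletonD insertI1)
    then show ?thesis
      by (auto simp: kernel_def aug_chain_group_def)
  qed
  finally have N: "aug_boundaries X = kernel aug_chain_group integer_group ?h" .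
  have "i \<in> ?h ` carrier aug_chain_group" for i
    by (rule image_eqI [of _ _ "frag_cmul i (frag_of ?e)"])
       (auto simp: aug_chain_group_def dest: subsetD [OF keys_cmul])
  then have "?h ` carrier aug_chain_group = carrier integer_group"
    by auto
  then have "aug_chain_group Mod aug_boundaries X \<cong> integer_group"
    unfolding N by (rule group_hom.FactGroup_iso [OF h])
  then show ?thesis
    by (simp add: aug_homology_group_def)
qed

lemma aug_hom_induced_coset:
  assumes "continuous_map X Y f"
  shows "aug_hom_induced (-1) X Y f (aug_boundaries X #>\<^bsub>aug_chain_group\<^esub> a) =
         aug_boundaries Y #>\<^bsub>aug_chain_group\<^esub> augmentation a"
proof -
  have sub: "augmentation b \<in> aug_boundaries Y" if b: "b \<in> aug_boundaries X" for b
  proof -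
    obtain d where d: "b = augmentation d" "singular_chain 0 X d"
      using b by (auto simp: aug_boundaries_def)
    then have "augmentation b = augmentation (chain_map 0 f d)"
      by (simp add: augmentation_augmentation augmentation_chain_map)
    then show ?thesis
      using d assms by (auto simp: aug_boundaries_def singular_chain_chain_map)
  qed
  have eq: "aug_boundaries Y #>\<^bsub>aug_chain_group\<^esub> augmentation (b + a) =
        aug_boundaries Y #>\<^bsub>aug_chain_group\<^esub> augmentation a"
    if "b \<in> aug_boundaries X" for b
  proof -
    interpret N: normal "aug_boundaries Y" aug_chain_group
      by (rule normal_aug_boundaries)
    have "augmentation (b + a) = augmentation b \<otimes>\<^bsub>aug_chain_group\<^esub> augmentation a"
      by (simp add: augmentation_add aug_chain_group_def)
    then show ?thesis
      using sub [OF that]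
      by (metis N.coset_join2 N.coset_mult_assoc N.is_subgroup N.subset augmentation_in_carrier)
  qed
  have "0 \<in> aug_boundaries X"
    by (auto simp: aug_boundaries_def intro: image_eqI [of _ _ 0])
  then have "aug_boundaries X \<noteq> {}"
    by blast
  moreover have "aug_boundaries X #>\<^bsub>aug_chain_group\<^esub> a = (\<lambda>b. b + a) ` aug_boundaries X"
    by (auto simp: r_coset_def aug_chain_group_def)
  ultimately show ?thesis
    using eq by (simp add: aug_hom_induced_def)
qed

lemma aug_hom_induced_hom:
  assumes "continuous_map X Y f"
  shows "aug_hom_induced p X Y f \<in> hom (aug_homology_group p X) (aug_homology_group p Y)"
proof (cases "p = -1")
  case True
  interpret NX: normal "aug_boundaries X" aug_chain_group
    by (rule normal_aug_boundaries)
  interpret NY: normal "aug_boundaries Y" aug_chain_group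
    by (rule normal_aug_boundaries)
  have add: "augmentation (a \<otimes>\<^bsub>aug_chain_group\<^esub> b) = 
      augmentation a \<otimes>\<^bsub>aug_chain_group\<^esub> (augmentation b)" for a b :: "'c chain"
    by (simp add: aug_chain_group_def augmentation_add)
  show ?thesis
    unfolding True
    by (auto simp: hom_def aug_homology_group_def carrier_FactGroup aug_hom_induced_coset [OF assms]
        NX.rcos_sum NY.rcos_sum augmentation_in_carrier add)
next
  case False
  then show ?thesis
    by (simp add: aug_hom_induced_def aug_homology_group_def hom_induced_reduced_hom)
qed

end

theory Submission
  imports Defs
begin

text \<open>
  In the chart \<open>\<phi>\<close> the statement is one about the cube \<open>J\<close>, its flat core \<open>J\<^sub>A\<close> and the disc
  \<open>w = \<phi> \<circ> f\<close>, whose boundary misses the core. Put \<open>m = n - k\<close>. The last \<open>m\<close> coordinates of \<open>w\<close>,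
  its normal part, do not vanish on the boundary of the disc, and they determine the homotopy class
  of the boundary in \<open>J - J\<^sub>A\<close>. So the assumption on homology says that the normal part,
  normalised to a self-map of the sphere of dimension \<open>m - 1\<close>, has non-zero degree
  (\<open>trivial_homomorphism_if_degree_0\<close>).

  Perturb the two inclusions by at most \<open>\<delta>\<close>. For small \<open>\<delta>\<close> the compact sets \<open>\<phi>\<^sup>-\<^sup>1(J\<^sub>A)\<close> and
  \<open>f(D\<^sup>m)\<close> stay in the domain of the chart, and there the perturbations become a map \<open>a\<close> close to the
  inclusion of \<open>J\<^sub>A\<close> and a map \<open>b\<close> close to \<open>w\<close> (\<open>uniformly_close_near_compact\<close>). If the perturbed
  sets did not meet, \<open>(y, x) \<mapsto> a x - b y\<close> would have no zero on \<open>D\<^sup>m \<times> J\<^sub>A\<close>. On the boundary of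
  this product it is, up to signs of coordinates and a homotopy along segments avoiding \<open>0\<close>, the map
  sending \<open>y\<close> to the normal part of \<open>w y\<close> and fixing \<open>x\<close>, which is the \<open>k\<close>-fold suspension of the normal
  part. A map that extends over the ball without zeros has degree \<open>0\<close> (\<open>degree_eq_0_if_extends\<close>), but
  suspension preserves the degree (\<open>degree_suspension\<close>), a contradiction
  (\<open>core_intersection_stable\<close>). For \<open>m = 0\<close> the normal part is a map of the empty sphere, and its
  suspensions are identity maps, of degree \<open>1\<close>.
\<close>

section \<open>The maximum norm, cubes and their boundaries\<close>

lemma Euclidean_space_eq: "Euclidean_space n = top_of_set {x. \<forall>i\<ge>n. x i = 0}"
  by (simp add: Euclidean_space_def euclidean_product_topology)

lemma subtopology_Euclidean_space:
  "S \<subseteq> topspace (Euclidean_space n) \<Longrightarrow> subtopology (Euclidean_space n) S = top_of_set S"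
  by (simp add: Euclidean_space_eq subtopology_subtopology inf.absorb2)

lemma continuous_map_Euclidean_subspace_iff:
  assumes "S \<subseteq> topspace (Euclidean_space m)"
  shows "continuous_map (subtopology (Euclidean_space m) S) (Euclidean_space n) f \<longleftrightarrow>
           continuous_on S f \<and> f \<in> S \<rightarrow> topspace (Euclidean_space n)"
  using assms by (simp add: cm_Euclidean_space_iff_continuous_on inf.absorb2)

lemma nsphere_eq: "nsphere N = top_of_set (topspace (nsphere N))"
  by (simp add: nsphere euclidean_product_topology)

lemma continuous_on_coordinate [continuous_intros]: "continuous_on S (\<lambda>x. x (i::nat) :: real)"
  by (rule continuous_on_subset [OF continuous_on_product_coordinates]) simp

lemma max_norm_0 [simp]: "max_norm 0 x = 0"
  by (simp add: max_norm_def)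

lemma max_norm_Suc: "max_norm (Suc n) x = max \<bar>x n\<bar> (max_norm n x)"
proof -
  have "insert 0 ((\<lambda>i. \<bar>x i\<bar>) ` {..<Suc n}) = insert \<bar>x n\<bar> (insert 0 ((\<lambda>i. \<bar>x i\<bar>) ` {..<n}))"
    by (auto simp: lessThan_Suc)
  then show ?thesis
    unfolding max_norm_def by (simp add: Max_insert)
qed

lemma max_norm_le_iff: "0 \<le> r \<Longrightarrow> max_norm n x \<le> r \<longleftrightarrow> (\<forall>i<n. \<bar>x i\<bar> \<le> r)"
  by (induction n) (auto simp: max_norm_Suc less_Suc_eq)

lemma max_norm_nonneg: "0 \<le> max_norm n x"
  by (induction n) (auto simp: max_norm_Suc)

lemma abs_le_max_norm: "i < n \<Longrightarrow> \<bar>x i\<bar> \<le> max_norm n x"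
  using max_norm_le_iff [OF max_norm_nonneg, of n x n x] by simp

lemma max_norm_attained: "max_norm n x \<noteq> 0 \<Longrightarrow> \<exists>i<n. \<bar>x i\<bar> = max_norm n x"
proof (induction n)
  case (Suc n)
  then show ?case
    by (cases "\<bar>x n\<bar> \<le> max_norm n x") (auto simp: max_norm_Suc max_def less_Suc_eq)
qed simp

lemma max_norm_cmult: "max_norm n (\<lambda>i. c * x i) = \<bar>c\<bar> * max_norm n x"
  by (induction n) (auto simp: max_norm_Suc abs_mult max_mult_distrib_left)

lemma max_norm_cong: "(\<And>i. i < n \<Longrightarrow> x i = y i) \<Longrightarrow> max_norm n x = max_norm n y"
  by (simp add: max_norm_def)

lemma max_norm_eq_0_iff: "max_norm n x = 0 \<longleftrightarrow> (\<forall>i<n. x i = 0)"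
  using max_norm_le_iff [of 0 n x] max_norm_nonneg [of n x] by auto

lemma continuous_on_max_norm [continuous_intros]: "continuous_on S (max_norm n)"
  by (induction n) (auto simp: max_norm_Suc intro!: continuous_intros)

lemma max_dist_le_iff: "0 \<le> r \<Longrightarrow> max_dist n x y \<le> r \<longleftrightarrow> (\<forall>i<n. \<bar>x i - y i\<bar> \<le> r)"
  by (simp add: max_dist_def max_norm_le_iff)

lemma cube_eq: "0 \<le> r \<Longrightarrow> cube n r = {x. (\<forall>i\<ge>n. x i = 0) \<and> max_norm n x \<le> r}"
  by (force simp: cube_def topspace_Euclidean_space max_norm_le_iff abs_le_iff)

lemma cube_subset_Euclidean: "cube n r \<subseteq> topspace (Euclidean_space n)"
  by (auto simp: cube_def)

lemma compact_cube: "compact (cube n r)"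
proof -
  have "compact (Pi\<^sub>E UNIV (\<lambda>i. if i < n then {-r..r} else {0::real}))"
    using compactin_PiE [of "\<lambda>i::nat. euclideanreal" UNIV "\<lambda>i. if i < n then {-r..r} else {0::real}"]
    by (auto simp: euclidean_product_topology)
  also have "Pi\<^sub>E UNIV (\<lambda>i. if i < n then {-r..r} else {0::real}) = cube n r"
    by (auto simp: cube_def topspace_Euclidean_space PiE_iff split: if_split_asm)
  finally show ?thesis .
qed

text \<open>
A point of norm \<open>1\<close> is not interior: stretching it by a factor slightly above \<open>1\<close> leaves the cube.
For \<open>n = 0\<close> both sides are empty.
\<close>

lemma cube_sphere_eq: "cube_sphere n = {x. (\<forall>i\<ge>n. x i = 0) \<and> max_norm n x = 1}"
proof -
  let ?E = "{x. \<forall>i\<ge>n. x i = (0::real)}"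
  have "closedin (Euclidean_space n) (cube n 1)"
    by (simp add: closedin_Euclidean_space_iff compact_cube compact_imp_closed cube_subset_Euclidean)
  then have cl: "Euclidean_space n closure_of cube n 1 = cube n 1"
    by (rule closure_of_closedin)
  have op: "openin (Euclidean_space n) {x \<in> ?E. max_norm n x < 1}"
  proof -
    have "open {x. max_norm n x < 1}"
      by (intro open_Collect_less continuous_intros)
    then show ?thesis
      by (auto simp: Euclidean_space_eq openin_open)
  qed
  have "max_norm n x < 1" if x: "x \<in> Euclidean_space n interior_of cube n 1" for x
  proof -
    obtain T where T: "openin (Euclidean_space n) T" "T \<subseteq> cube n 1" "x \<in> T"
      using x by (auto simp: interior_of_def)
    obtain W where W: "open W" "T = ?E \<inter> W"
      using T by (auto simp: Euclidean_space_eq openin_open)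
    have "continuous_on UNIV (\<lambda>t::real. \<lambda>i. t * x i)"
      by (intro continuous_on_coordinatewise_then_product continuous_intros)
    then have "open ((\<lambda>t::real. \<lambda>i. t * x i) -` W)"
      using W open_vimage by blast
    moreover have "1 \<in> (\<lambda>t::real. \<lambda>i. t * x i) -` W"
      using T W by simp
    ultimately obtain e where e: "e > 0" "ball 1 e \<subseteq> (\<lambda>t::real. \<lambda>i. t * x i) -` W"
      by (meson open_contains_ball)
    then have "1 + e/2 \<in> (\<lambda>t::real. \<lambda>i. t * x i) -` W"
      by (intro subsetD [OF e(2)]) (auto simp: dist_real_def)
    then have "(\<lambda>i. (1 + e/2) * x i) \<in> T"
      using T W by auto
    then have "(1 + e/2) * max_norm n x \<le> 1"
      using T e by (auto simp: cube_eq max_norm_cmult dest!: subsetD)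
    moreover have "max_norm n x < (1 + e/2) * max_norm n x" if "max_norm n x > 0"
      using e that by simp
    ultimately show ?thesis
      by (cases "max_norm n x > 0") linarith+
  qed
  moreover have "{x \<in> ?E. max_norm n x < 1} \<subseteq> Euclidean_space n interior_of cube n 1"
    by (rule interior_of_maximal [OF _ op]) (auto simp: cube_eq)
  ultimately have "Euclidean_space n interior_of cube n 1 = {x \<in> ?E. max_norm n x < 1}"
    using interior_of_subset_topspace [of "Euclidean_space n" "cube n 1"]
    by (auto simp: topspace_Euclidean_space)
  then show ?thesis
    unfolding cube_sphere_def frontier_of_def cl by (auto simp: cube_eq)
qed

section \<open>Punctured space and spheres\<close>

text \<open>
Degrees live on the round sphere, whereas the cubes are the unit balls of the maximum norm. The two
radial projections of punctured space pass between the round sphere and the boundary of the cube.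
Both scale by a positive factor, so they preserve signs of coordinates.
\<close>

definition punctured :: "nat \<Rightarrow> (nat \<Rightarrow> real) set" where
  "punctured n = topspace (Euclidean_space n) - {\<lambda>i. 0}"

definition unit_vector :: "nat \<Rightarrow> (nat \<Rightarrow> real) \<Rightarrow> nat \<Rightarrow> real" where
  "unit_vector N x = (\<lambda>i. x i / sqrt (\<Sum>j\<le>N. (x j)\<^sup>2))"

definition cube_radial :: "nat \<Rightarrow> (nat \<Rightarrow> real) \<Rightarrow> nat \<Rightarrow> real" where
  "cube_radial n x = (\<lambda>i. x i / max_norm n x)"

lemma topspace_nsphere: "topspace (nsphere N) = {x. (\<Sum>i\<le>N. (x i)\<^sup>2) = 1 \<and> (\<forall>i>N. x i = 0)}"
  by (simp add: nsphere)

lemma sum_squares_punctured: "x \<in> punctured (Suc N) \<Longrightarrow> 0 < (\<Sum>j\<le>N. (x j)\<^sup>2)"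
proof -
  assume x: "x \<in> punctured (Suc N)"
  then obtain i where "x i \<noteq> 0"
    by (auto simp: punctured_def)
  moreover then have "i \<le> N"
    using x by (auto simp: punctured_def topspace_Euclidean_space not_less_eq_eq)
  ultimately show ?thesis
    by (intro sum_pos2 [of _ i]) auto
qed

lemma unit_vector_in_nsphere: "x \<in> punctured (Suc N) \<Longrightarrow> unit_vector N x \<in> topspace (nsphere N)"
  using sum_squares_punctured [of x N]
  by (auto simp: topspace_nsphere unit_vector_def punctured_def topspace_Euclidean_space power_divide
      simp flip: sum_divide_distrib)

lemma nsphere_subset_punctured: "topspace (nsphere N) \<subseteq> punctured (Suc N)"
  by (auto simp: topspace_nsphere punctured_def topspace_Euclidean_space)

lemma continuous_on_unit_vector: "continuous_on (punctured (Suc N)) (unit_vector N)"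
  unfolding unit_vector_def
  by (intro continuous_on_coordinatewise_then_product continuous_intros)
     (auto dest: sum_squares_punctured)

lemma unit_vector_cmult: "0 < c \<Longrightarrow> unit_vector N (\<lambda>i. c * x i) = unit_vector N x"
proof -
  assume c: "0 < c"
  have "(\<Sum>j\<le>N. (c * x j)\<^sup>2) = c\<^sup>2 * (\<Sum>j\<le>N. (x j)\<^sup>2)"
    by (simp add: power_mult_distrib sum_distrib_left)
  then show ?thesis
    using c by (simp add: unit_vector_def real_sqrt_mult)
qed

lemma unit_vector_nsphere: "x \<in> topspace (nsphere N) \<Longrightarrow> unit_vector N x = x"
  by (simp add: unit_vector_def topspace_nsphere)

lemma max_norm_punctured: "x \<in> punctured n \<Longrightarrow> 0 < max_norm n x"
proof -
  assume "x \<in> punctured n"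
  then have "\<exists>i<n. x i \<noteq> 0"
    by (force simp: punctured_def topspace_Euclidean_space fun_eq_iff not_le)
  then show ?thesis
    using max_norm_nonneg [of n x] max_norm_eq_0_iff [of n x] by force
qed

lemma continuous_on_cube_radial: "continuous_on (punctured n) (cube_radial n)"
  unfolding cube_radial_def
  by (intro continuous_on_coordinatewise_then_product continuous_intros)
     (auto dest: max_norm_punctured)

lemma max_norm_cube_radial: "max_norm n x \<noteq> 0 \<Longrightarrow> max_norm n (cube_radial n x) = 1"
  using max_norm_cmult [of n "inverse (max_norm n x)" x] max_norm_nonneg [of n x]
  by (simp add: cube_radial_def divide_inverse_commute)

lemma cube_radial_in_cube_sphere: "x \<in> punctured n \<Longrightarrow> cube_radial n x \<in> cube_sphere n"
  using max_norm_cube_radial [of n x] max_norm_punctured [of x n]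
  by (auto simp: cube_sphere_eq cube_radial_def punctured_def topspace_Euclidean_space)

lemma cube_sphere_subset_punctured: "cube_sphere n \<subseteq> punctured n"
  by (auto simp: cube_sphere_eq punctured_def topspace_Euclidean_space)
     (simp add: max_norm_def image_constant_conv split: if_split_asm)

lemma cube_radial_unit_vector: "x \<in> cube_sphere (Suc N) \<Longrightarrow> cube_radial (Suc N) (unit_vector N x) = x"
proof -
  assume x: "x \<in> cube_sphere (Suc N)"
  define c where "c = inverse (sqrt (\<Sum>j\<le>N. (x j)\<^sup>2))"
  have "c > 0"
    using sum_squares_punctured cube_sphere_subset_punctured x by (auto simp: c_def)
  moreover have "unit_vector N x = (\<lambda>i. c * x i)"
    by (simp add: unit_vector_def c_def divide_inverse_commute)
  moreover have "max_norm (Suc N) x = 1"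
    using x by (simp add: cube_sphere_eq)
  ultimately show ?thesis
    using max_norm_cmult [of "Suc N" c x] by (simp add: cube_radial_def)
qed

lemma continuous_map_top_of_set_iff:
  "continuous_map (top_of_set S) (top_of_set T) f \<longleftrightarrow> continuous_on S f \<and> f \<in> S \<rightarrow> T"
  by (auto simp: continuous_map_in_subtopology)

lemma straight_line_homotopic:
  fixes f g :: "(nat \<Rightarrow> real) \<Rightarrow> nat \<Rightarrow> real"
  assumes "continuous_on S f" "continuous_on S g"
    and "\<And>x t. \<lbrakk>x \<in> S; 0 \<le> t; t \<le> 1\<rbrakk> \<Longrightarrow> (\<lambda>i. (1 - t) * f x i + t * g x i) \<in> T"
  shows "homotopic_with_canon (\<lambda>x. True) S T f g"
proof -
  let ?h = "\<lambda>(t, x) i. (1 - t) * f x i + t * g x i"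
  have snd: "continuous_on ({0..1} \<times> S) snd" "snd ` ({0..1} \<times> S) \<subseteq> S"
    by (auto intro: continuous_on_snd continuous_on_id)
  have "continuous_on ({0..1} \<times> S) (\<lambda>y. f (snd y) i)" "continuous_on ({0..1} \<times> S) (\<lambda>y. g (snd y) i)" for i
    by (rule continuous_on_compose2 [OF continuous_on_product_then_coordinatewise [OF assms(1)] snd])
       (rule continuous_on_compose2 [OF continuous_on_product_then_coordinatewise [OF assms(2)] snd])
  then have "continuous_on ({0..1} \<times> S) ?h"
    unfolding case_prod_unfold
    by (intro continuous_on_coordinatewise_then_product continuous_intros) auto
  then have "continuous_map (prod_topology (top_of_set {0..1}) (top_of_set S)) (top_of_set T) ?h"
    using assms(3) by (auto simp: prod_topology_subtopology_eu continuous_map_in_subtopology)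
  then show ?thesis
    unfolding homotopic_with_def by (intro exI [of _ ?h]) auto
qed

section \<open>Degrees of maps of spheres\<close>

text \<open>
Naturality of three isomorphisms: the connecting map of the contractible upper hemisphere relative to
the equator, excision of the lower hemisphere, and the passage to homology relative to the
contractible lower hemisphere. Together they identify the reduced homology of the equator with that
of the sphere one degree higher, and a map preserving both hemispheres commutes with each of them.
This is the suspension property of the degree in a form that needs no formula for the suspension.
\<close>

lemma Brouwer_degree2_equator:
  assumes f: "continuous_map (nsphere (Suc n)) (nsphere (Suc n)) f"
    and up: "\<And>x. 0 \<le> x (Suc n) \<Longrightarrow> 0 \<le> f x (Suc n)"
    and lo: "\<And>x. x (Suc n) \<le> 0 \<Longrightarrow> f x (Suc n) \<le> 0"
  shows "Brouwer_degree2 (Suc n) f = Brouwer_degree2 n f"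
proof -
  let ?S = "nsphere (Suc n)"
  let ?U = "subtopology ?S {x. 0 \<le> x (Suc n)}"
  let ?eq = "{x. x (Suc n) = (0::real)}"
  let ?L = "{x. x (Suc n) \<le> (0::real)}"
  let ?q = "1 + int n"
  let ?G0 = "reduced_homology_group (int n) (nsphere n)"
  let ?G1 = "reduced_homology_group ?q ?S"
  let ?GU = "relative_homology_group ?q ?U ?eq"
  let ?GL = "relative_homology_group ?q ?S ?L"
  let ?b = "hom_boundary ?q ?U ?eq"
  let ?i = "hom_induced ?q ?U ?eq ?S ?L id"
  let ?j = "hom_induced ?q ?S {} ?S ?L id"
  let ?f0 = "hom_induced (int n) (nsphere n) {} (nsphere n) {} f"
  let ?f1 = "hom_induced ?q ?S {} ?S {} f"
  let ?fU = "hom_induced ?q ?U ?eq ?U ?eq f"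
  let ?fL = "hom_induced ?q ?S ?L ?S ?L f"
  have eqU: "subtopology ?U ?eq = nsphere n"
  proof -
    have "{x. 0 \<le> x (Suc n)} \<inter> ?eq = ?eq" by auto
    then show ?thesis
      by (simp add: subtopology_subtopology subtopology_nsphere_equator)
  qed
  have fU: "continuous_map ?U ?U f"
    using f up by (auto simp: continuous_map_in_subtopology continuous_map_from_subtopology)
  have feq: "f \<in> ?eq \<rightarrow> ?eq"
    using up lo by (force intro: antisym)
  have fL: "f \<in> ?L \<rightarrow> ?L"
    using lo by auto
  have b: "?b \<in> iso ?GU ?G0"
    by (rule iso_upper_hemisphere_reduced_homology_group)
  have i: "?i \<in> iso ?GU ?GL"
    by (rule iso_relative_homology_group_upper_hemisphere)
  have j: "?j \<in> iso ?G1 ?GL"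
    by (simp add: iso_reduced_homology_group_lower_hemisphere)
  have inj_b: "inj_on ?b (carrier ?GU)" and inj_j: "inj_on ?j (carrier ?G1)"
    and surj_i: "?i ` carrier ?GU = carrier ?GL"
    using b i j by (auto simp: iso_def bij_betw_def)
  interpret b: group_hom ?GU ?G0 ?b
    using b by (auto simp: group_hom_def group_hom_axioms_def iso_def)
  interpret i: group_hom ?GU ?GL ?i
    using i by (auto simp: group_hom_def group_hom_axioms_def iso_def)
  interpret j: group_hom ?G1 ?GL ?j
    using j by (auto simp: group_hom_def group_hom_axioms_def iso_def)
  \<comment> \<open>Naturality; the two inclusions commute with \<open>f\<close> because \<open>f\<close> is a map of pairs.\<close>
  have f_b: "?f0 (?b e) = ?b (?fU e)" for e
    using naturality_hom_induced [OF fU feq, of ?q] by (simp add: eqU fun_eq_iff)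
  have f_i: "?fL (?i e) = ?i (?fU e)" for e
    using f feq fL fU
    by (simp add: hom_induced_compose' Collect_mono_iff)
  have f_j: "?fL (?j c) = ?j (?f1 c)" for c
    using f fL by (simp add: hom_induced_compose')
  have "?f1 c = c [^]\<^bsub>?G1\<^esub> Brouwer_degree2 n f" if c: "c \<in> carrier ?G1" for c
  proof -
    let ?d = "Brouwer_degree2 n f"
    have "?j c \<in> ?i ` carrier ?GU"
      unfolding surj_i using c by (rule j.hom_closed)
    then obtain e where e: "?j c = ?i e" "e \<in> carrier ?GU"
      by (rule imageE)
    have fe: "?fU e \<in> carrier ?GU"
      by (simp add: hom_induced_carrier)
    have "?b (?fU e) = ?b e [^]\<^bsub>?G0\<^esub> ?d"
      using f_b [of e] Brouwer_degree2 [OF b.hom_closed [OF e(2)]] by simp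
    also have "\<dots> = ?b (e [^]\<^bsub>?GU\<^esub> ?d)"
      using e(2) by (rule b.hom_int_pow [symmetric])
    finally have fU_e: "?fU e = e [^]\<^bsub>?GU\<^esub> ?d"
      by (rule inj_onD [OF inj_b]) (use e(2) fe in auto)
    have "?j (?f1 c) = ?i (?fU e)"
      unfolding f_j [symmetric] e(1) by (rule f_i)
    also have "\<dots> = ?i e [^]\<^bsub>?GL\<^esub> ?d"
      unfolding fU_e using e(2) by (rule i.hom_int_pow)
    also have "\<dots> = ?j (c [^]\<^bsub>?G1\<^esub> ?d)"
      unfolding e(1) [symmetric] using c by (rule j.hom_int_pow [symmetric])
    finally show ?thesis
      by (rule inj_onD [OF inj_j]) (use c hom_induced_reduced [OF c] in auto)
  qed
  then show ?thesis
    by (intro Brouwer_degree2_unique f) simp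
qed

lemma continuous_map_nsphere_iff:
  "continuous_map (nsphere N) (nsphere M) f \<longleftrightarrow>
     continuous_on (topspace (nsphere N)) f \<and> f \<in> topspace (nsphere N) \<rightarrow> topspace (nsphere M)"
proof -
  have "continuous_map (top_of_set S) (top_of_set T) f \<longleftrightarrow> continuous_on S f \<and> f \<in> S \<rightarrow> T" for S T
    by (auto simp: continuous_map_in_subtopology)
  then show ?thesis
    by (metis nsphere_eq)
qed

text \<open>
The equator of \<open>nsphere (Suc M)\<close> is cut out by the last coordinate. A map that leaves this
coordinate alone preserves the hemispheres after normalisation, and restricts on the equator
to the same map with one coordinate fewer. Iterating, fixing further coordinates does not change the
degree.
\<close>

lemma degree_suspension:
  fixes Q :: "(nat \<Rightarrow> real) \<Rightarrow> nat \<Rightarrow> real"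
  assumes cont: "\<And>n. m \<le> n \<Longrightarrow> continuous_on (punctured n) Q"
    and into: "\<And>n. m \<le> n \<Longrightarrow> Q \<in> punctured n \<rightarrow> punctured n"
    and fixes_last: "\<And>x i. m \<le> i \<Longrightarrow> Q x i = x i"
    and m: "m \<le> Suc N"
  shows "Brouwer_degree2 (N + j) (unit_vector (N + j) \<circ> Q) = Brouwer_degree2 N (unit_vector N \<circ> Q)"
proof (induction j)
  case (Suc j)
  let ?M = "N + j"
  have mM: "m \<le> Suc ?M" "m \<le> Suc (Suc ?M)"
    using m by auto
  have S: "x \<in> punctured (Suc (Suc ?M))" if "x \<in> topspace (nsphere (Suc ?M))" for x
    using that nsphere_subset_punctured by blast
  have Q: "Q x \<in> punctured (Suc (Suc ?M))" if "x \<in> punctured (Suc (Suc ?M))" for x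
    using that into [OF mM(2)] by blast
  have "continuous_on (topspace (nsphere (Suc ?M))) (unit_vector (Suc ?M) \<circ> Q)"
    by (intro continuous_on_compose continuous_on_subset [OF continuous_on_unit_vector]
        continuous_on_subset [OF cont [OF mM(2)]]) (auto intro: S Q [OF S])
  moreover have "unit_vector (Suc ?M) \<circ> Q \<in> topspace (nsphere (Suc ?M)) \<rightarrow> topspace (nsphere (Suc ?M))"
    by (auto intro!: unit_vector_in_nsphere [OF Q [OF S]])
  ultimately have "continuous_map (nsphere (Suc ?M)) (nsphere (Suc ?M)) (unit_vector (Suc ?M) \<circ> Q)"
    by (simp add: continuous_map_nsphere_iff)
  then have "Brouwer_degree2 (Suc ?M) (unit_vector (Suc ?M) \<circ> Q) = Brouwer_degree2 ?M (unit_vector (Suc ?M) \<circ> Q)"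
    using fixes_last mM
    by (intro Brouwer_degree2_equator)
       (auto simp: unit_vector_def sum_nonneg divide_nonneg_nonneg divide_nonpos_nonneg simp del: sum.atMost_Suc)
  also have "\<dots> = Brouwer_degree2 ?M (unit_vector ?M \<circ> Q)"
    using fixes_last mM by (intro Brouwer_degree2_eq) (simp add: topspace_nsphere unit_vector_def)
  finally show ?case
    by (simp only: Suc add_Suc_right)
qed simp

text \<open>
A map of the boundary of a cube that is joined by a segment homotopy to the boundary values of a
zero-free map of the cube is null-homotopic in punctured space: contract the cube to its centre.
\<close>

lemma degree_eq_0_if_extends:
  assumes G: "continuous_on (cube (Suc N) 1) G" "G \<in> cube (Suc N) 1 \<rightarrow> punctured (Suc N)"
    and Q: "continuous_on (cube_sphere (Suc N)) Q"
    and seg: "\<And>z t. \<lbrakk>z \<in> cube_sphere (Suc N); 0 \<le> t; t \<le> 1\<rbrakk>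
                \<Longrightarrow> (\<lambda>i. (1 - t) * G z i + t * Q z i) \<in> punctured (Suc N)"
  shows "Brouwer_degree2 N (unit_vector N \<circ> Q \<circ> cube_radial (Suc N)) = 0"
proof -
  let ?S = "topspace (nsphere N)" and ?P = "punctured (Suc N)" and ?r = "cube_radial (Suc N)"
  let ?C = "cube (Suc N) 1" and ?B = "cube_sphere (Suc N)"
  have BC: "?B \<subseteq> ?C"
    by (auto simp: cube_sphere_eq cube_eq)
  have r: "continuous_on ?S ?r" "?r \<in> ?S \<rightarrow> ?B"
    using nsphere_subset_punctured [of N] continuous_on_cube_radial [of "Suc N"] cube_radial_in_cube_sphere
    by (blast intro: continuous_on_subset)+
  have "homotopic_with_canon (\<lambda>x. True) ?S ?C ?r (\<lambda>x i. 0)"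
  proof (rule straight_line_homotopic [OF r(1)])
    fix x and t :: real
    assume x: "x \<in> ?S" and t: "0 \<le> t" "t \<le> 1"
    then have "?r x \<in> ?B"
      using r by blast
    then show "(\<lambda>i. (1 - t) * ?r x i + t * 0) \<in> ?C"
      using t by (auto simp: cube_sphere_eq cube_eq max_norm_cmult)
  qed (intro continuous_on_coordinatewise_then_product continuous_intros)
  then have "homotopic_with_canon (\<lambda>x. True) ?S ?P (G \<circ> ?r) (G \<circ> (\<lambda>x i. 0))"
    by (rule homotopic_with_compose_continuous_map_left) (use G in \<open>auto simp: continuous_map_in_subtopology\<close>)
  moreover have "homotopic_with_canon (\<lambda>x. True) ?B ?P G Q"
    using G(1) BC Q seg by (intro straight_line_homotopic) (auto intro: continuous_on_subset)
  then have "homotopic_with_canon (\<lambda>x. True) ?S ?P (G \<circ> ?r) (Q \<circ> ?r)"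
    by (rule homotopic_with_compose_continuous_map_right) (use r in \<open>auto simp: continuous_map_in_subtopology\<close>)
  ultimately have "homotopic_with_canon (\<lambda>x. True) ?S ?P (Q \<circ> ?r) (G \<circ> (\<lambda>x i. 0))"
    using homotopic_with_symD homotopic_with_trans by blast
  then have "homotopic_with_canon (\<lambda>x. True) ?S ?S (unit_vector N \<circ> (Q \<circ> ?r)) (unit_vector N \<circ> (G \<circ> (\<lambda>x i. 0)))"
    by (rule homotopic_with_compose_continuous_map_left)
       (auto simp: continuous_map_in_subtopology continuous_on_unit_vector unit_vector_in_nsphere)
  then have "homotopic_with (\<lambda>x. True) (nsphere N) (nsphere N) (unit_vector N \<circ> Q \<circ> ?r) (\<lambda>x. unit_vector N (G (\<lambda>i. 0)))"
    by (simp add: o_def flip: nsphere_eq)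
  then show ?thesis
    by (rule Brouwer_degree2_nullhomotopic)
qed

text \<open>
If source and target of a map are, through \<open>r\<close>, \<open>s\<close> and \<open>i\<close>, \<open>q\<close>, as good as spheres, the induced
homomorphism factors through the one induced by the self-map \<open>q \<circ> w \<circ> r\<close> of the sphere, which is
multiplication by its degree.
\<close>

lemma trivial_homomorphism_if_degree_0:
  assumes w: "continuous_map X Y w"
    and r: "continuous_map (nsphere N) X r" and s: "continuous_map X (nsphere N) s"
    and rs: "homotopic_with (\<lambda>_. True) X X (r \<circ> s) id"
    and i: "continuous_map (nsphere N) Y i" and q: "continuous_map Y (nsphere N) q"
    and iq: "homotopic_with (\<lambda>_. True) Y Y (i \<circ> q) id"
    and deg: "Brouwer_degree2 N (q \<circ> w \<circ> r) = 0"
  shows "trivial_homomorphism (reduced_homology_group (int N) X) (reduced_homology_group (int N) Y)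
           (hom_induced (int N) X {} Y {} w)"
proof -
  let ?S = "nsphere N"
  have "hom_induced (int N) X {} Y {} w c = \<one>\<^bsub>reduced_homology_group (int N) Y\<^esub>" if c: "c \<in> carrier (reduced_homology_group (int N) X)" for c
  proof -
    have "homotopic_with (\<lambda>_. True) X Y (w \<circ> (r \<circ> s)) (w \<circ> id)"
      by (rule homotopic_with_compose_continuous_map_left [OF rs w]) simp
    moreover have "homotopic_with (\<lambda>_. True) X Y (i \<circ> q \<circ> (w \<circ> (r \<circ> s))) (id \<circ> (w \<circ> (r \<circ> s)))"
      by (rule homotopic_with_compose_continuous_map_right [OF iq]) (auto intro!: continuous_map_compose r s w)
    ultimately have "homotopic_with (\<lambda>_. True) X Y (i \<circ> (q \<circ> w \<circ> r) \<circ> s) w"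
      by (simp add: o_assoc) (metis (no_types) homotopic_with_trans)
    then have "hom_induced (int N) X {} Y {} w = hom_induced (int N) X {} Y {} (i \<circ> (q \<circ> w \<circ> r) \<circ> s)"
      using homology_homotopy_empty by metis
    also have "\<dots> = hom_induced (int N) ?S {} Y {} (i \<circ> (q \<circ> w \<circ> r)) \<circ> hom_induced (int N) X {} ?S {} s"
      by (intro hom_induced_compose_empty s continuous_map_compose [OF _ i] continuous_map_compose [OF r]
          continuous_map_compose [OF w q])
    also have "hom_induced (int N) ?S {} Y {} (i \<circ> (q \<circ> w \<circ> r)) = hom_induced (int N) ?S {} Y {} i \<circ> hom_induced (int N) ?S {} ?S {} (q \<circ> w \<circ> r)"
      by (intro hom_induced_compose_empty i continuous_map_compose [OF r] continuous_map_compose [OF w q])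
    finally have "hom_induced (int N) X {} Y {} w c = hom_induced (int N) ?S {} Y {} i (hom_induced (int N) ?S {} ?S {} (q \<circ> w \<circ> r) (hom_induced (int N) X {} ?S {} s c))"
      by simp
    also have "hom_induced (int N) ?S {} ?S {} (q \<circ> w \<circ> r) (hom_induced (int N) X {} ?S {} s c) = \<one>\<^bsub>reduced_homology_group (int N) ?S\<^esub>"
      by (subst Brouwer_degree2) (simp_all add: deg hom_induced_reduced [OF c])
    also have "hom_induced (int N) ?S {} Y {} i \<one>\<^bsub>reduced_homology_group (int N) ?S\<^esub> = \<one>\<^bsub>reduced_homology_group (int N) Y\<^esub>"
      using hom_induced_reduced_hom by (rule hom_one) auto
    finally show ?thesis .
  qed
  then show ?thesis
    by (simp add: trivial_homomorphism_def hom_induced_reduced_hom)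
qed

section \<open>Suspending the normal part of a disc\<close>

definition trunc :: "nat \<Rightarrow> (nat \<Rightarrow> real) \<Rightarrow> nat \<Rightarrow> real" where
  "trunc m z = (\<lambda>i. if i < m then z i else 0)"

text \<open>
Write a point as \<open>z = (y, x)\<close> with \<open>y \<in> \<real>\<^sup>m\<close>. The map is \<open>(y, x) \<mapsto> (q y, x)\<close>, where \<open>q\<close> is the
positively homogeneous extension of the normal part of \<open>w\<close>, its coordinates from \<open>k\<close> on, from the
boundary of the cube to all of \<open>\<real>\<^sup>m\<close>; at \<open>y = 0\<close> the factor \<open>max_norm m z\<close> makes it vanish. On
spheres this is the join of the normal part with an identity, that is, its \<open>k\<close>-fold suspension. The
normal coordinates come first so that the suspension coordinates come last.
\<close>

definition normal_join :: "nat \<Rightarrow> nat \<Rightarrow> ((nat \<Rightarrow> real) \<Rightarrow> nat \<Rightarrow> real) \<Rightarrow> (nat \<Rightarrow> real) \<Rightarrow> nat \<Rightarrow> real" where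
  "normal_join m k w z =
     (\<lambda>i. if i < m then max_norm m z * w (cube_radial m (trunc m z)) (k + i) else z i)"

lemma max_norm_trunc [simp]: "max_norm m (trunc m z) = max_norm m z"
  by (rule max_norm_cong) (simp add: trunc_def)

lemma cube_radial_trunc_in_cube: "cube_radial m (trunc m z) \<in> cube m 1"
proof -
  have "max_norm m (cube_radial m (trunc m z)) \<le> 1"
    by (cases "max_norm m z = 0") (simp_all add: max_norm_cube_radial, simp add: cube_radial_def max_norm_le_iff)
  then show ?thesis
    by (simp add: cube_eq) (simp add: cube_radial_def trunc_def)
qed

lemma cube_radial_trunc_in_cube_sphere:
  "max_norm m z \<noteq> 0 \<Longrightarrow> cube_radial m (trunc m z) \<in> cube_sphere m"
  by (simp add: cube_sphere_eq max_norm_cube_radial) (simp add: cube_radial_def trunc_def)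

lemma normal_join_cmult:
  assumes "0 < c" shows "normal_join m k w (\<lambda>i. c * z i) = (\<lambda>i. c * normal_join m k w z i)"
proof -
  have "cube_radial m (trunc m (\<lambda>i. c * z i)) = cube_radial m (trunc m z)"
    using assms by (simp add: cube_radial_def max_norm_cmult) (auto simp: trunc_def)
  then show ?thesis
    using assms by (auto simp: normal_join_def max_norm_cmult)
qed

text \<open>
Off \<open>y = 0\<close> the map is a composition of continuous maps; at \<open>y = 0\<close> it is continuous because \<open>w\<close> is
bounded.
\<close>

lemma continuous_on_normal_join:
  assumes w: "continuous_on (cube m 1) w" "w \<in> cube m 1 \<rightarrow> cube (m + k) 1"
  shows "continuous_on S (normal_join m k w)"
proof -
  have "continuous_on UNIV (\<lambda>z. normal_join m k w z i)" for i
  proof (cases "i < m")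
    case True
    let ?v = "\<lambda>z. w (cube_radial m (trunc m z)) (k + i)"
    let ?f = "\<lambda>z. max_norm m z * ?v z"
    have v: "\<bar>?v z\<bar> \<le> 1" for z
    proof -
      have "w (cube_radial m (trunc m z)) \<in> cube (m + k) 1"
        using w(2) cube_radial_trunc_in_cube by blast
      then show ?thesis
        using True by (auto simp: cube_eq max_norm_le_iff)
    qed
    let ?D = "{z. max_norm m z \<noteq> 0}"
    have "open ?D"
      by (intro open_Collect_neq continuous_intros)
    have "continuous_on ?D (\<lambda>z. trunc m z j / max_norm m z)" for j
      by (cases "j < m") (auto simp: trunc_def intro!: continuous_intros)
    then have "continuous_on ?D (\<lambda>z. cube_radial m (trunc m z))"
      unfolding cube_radial_def by (intro continuous_on_coordinatewise_then_product) simp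
    then have "continuous_on ?D ?v"
      using cube_radial_trunc_in_cube
      by (intro continuous_on_compose2 [OF continuous_on_product_then_coordinatewise [OF w(1)]]) auto
    then have "continuous_on ?D ?f"
      by (intro continuous_intros)
    then have "\<forall>z\<in>?D. isCont ?f z"
      by (simp only: continuous_on_eq_continuous_at [OF \<open>open ?D\<close>])
    moreover have "isCont ?f z" if z: "max_norm m z = 0" for z
    proof -
      have "(max_norm m \<longlongrightarrow> max_norm m z) (at z)"
        using continuous_on_max_norm [of UNIV m] continuous_on_eq_continuous_at [of UNIV "max_norm m"]
        by (auto simp: isCont_def)
      then have "(max_norm m \<longlongrightarrow> 0) (at z)"
        using z by simp
      then have "(?f \<longlongrightarrow> 0) (at z)"
        by (rule Lim_null_comparison [rotated])
           (simp add: abs_mult mult_left_le v max_norm_nonneg)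
      then show ?thesis
        using z by (simp add: isCont_def)
    qed
    ultimately have "continuous_on UNIV ?f"
      by (intro continuous_at_imp_continuous_on ballI) blast
    then show ?thesis
      using True by (simp add: normal_join_def)
  next
    case False
    then show ?thesis
      by (simp add: normal_join_def continuous_on_coordinate)
  qed
  then have "continuous_on UNIV (normal_join m k w)"
    by (rule continuous_on_coordinatewise_then_product)
  then show ?thesis
    by (rule continuous_on_subset) simp
qed

lemma normal_join_punctured:
  assumes normal: "\<And>y. y \<in> cube_sphere m \<Longrightarrow> \<exists>i<m. w y (k + i) \<noteq> 0" and "m \<le> n"
  shows "normal_join m k w \<in> punctured n \<rightarrow> punctured n"
proof
  fix z assume z: "z \<in> punctured n"
  then have "normal_join m k w z i = 0" if "n \<le> i" for i
    using \<open>m \<le> n\<close> that by (auto simp: normal_join_def punctured_def topspace_Euclidean_space)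
  moreover have "\<exists>i. normal_join m k w z i \<noteq> 0"
  proof (cases "max_norm m z = 0")
    case True
    obtain i where i: "z i \<noteq> 0"
      using z by (auto simp: punctured_def)
    then have "\<not> i < m"
      using True by (auto simp: max_norm_eq_0_iff)
    then show ?thesis
      using i by (auto simp: normal_join_def)
  next
    case False
    then show ?thesis
      using normal [OF cube_radial_trunc_in_cube_sphere [OF False]] by (auto simp: normal_join_def)
  qed
  ultimately show "normal_join m k w z \<in> punctured n"
    by (auto simp: punctured_def topspace_Euclidean_space)
qed

text \<open>
The core \<open>cube k (1 + \<nu>)\<close> is longer than the cube, so inside the cube it is the whole plane on which
the last \<open>m\<close> coordinates vanish.
\<close>

lemma cube_diff_core_iff:
  assumes "0 \<le> \<nu>"
  shows "x \<in> cube (m + k) 1 - cube k (1 + \<nu>) \<longleftrightarrow> x \<in> cube (m + k) 1 \<and> (\<exists>i<m. x (k + i) \<noteq> 0)"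
proof -
  have "x \<in> cube k (1 + \<nu>) \<longleftrightarrow> (\<forall>i<m. x (k + i) = 0)" if x: "x \<in> cube (m + k) 1"
  proof
    assume 0: "\<forall>i<m. x (k + i) = 0"
    have "x i = 0" if "k \<le> i" for i
    proof (cases "i < m + k")
      case True
      then show ?thesis
        using 0 [rule_format, of "i - k"] that by auto
    next
      case False
      then show ?thesis
        using x by (simp add: cube_eq)
    qed
    moreover have "\<bar>x i\<bar> \<le> 1" if "i < k" for i
      using x that by (simp add: cube_eq max_norm_le_iff)
    then have "max_norm k x \<le> 1 + \<nu>"
      using assms by (simp add: max_norm_le_iff add_increasing2)
    ultimately show "x \<in> cube k (1 + \<nu>)"
      using assms by (simp add: cube_eq)
  qed (use assms in \<open>auto simp: cube_eq\<close>)
  then show ?thesis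
    by auto
qed

text \<open>
By the suspension property the degree is that of the normal part of \<open>w\<close> on the boundary of
\<open>cube m 1\<close>. The complement of the core deforms along segments onto the sphere in the last \<open>m\<close>
coordinates, with \<open>v \<mapsto> v\<^sub>\<perp> / |v\<^sub>\<perp>|\<close> as homotopy inverse of the inclusion, so degree \<open>0\<close> would
make the homomorphism trivial. If \<open>m = 0\<close> there is no normal part, and the map is the identity.
\<close>

lemma degree_normal_join_nonzero:
  fixes w :: "(nat \<Rightarrow> real) \<Rightarrow> nat \<Rightarrow> real"
  assumes w: "continuous_on (cube m 1) w" "w \<in> cube m 1 \<rightarrow> cube (m + k) 1"
    and bd: "w ` cube_sphere m \<subseteq> cube (m + k) 1 - cube k (1 + \<nu>)"
    and \<nu>: "0 \<le> \<nu>"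
    and Suc: "m + k = Suc M"
    and hom: "\<not> trivial_homomorphism
           (aug_homology_group (int m - 1) (subtopology (Euclidean_space m) (cube_sphere m)))
           (aug_homology_group (int m - 1)
             (subtopology (Euclidean_space (m + k)) (cube (m + k) 1 - cube k (1 + \<nu>))))
           (aug_hom_induced (int m - 1) (subtopology (Euclidean_space m) (cube_sphere m))
             (subtopology (Euclidean_space (m + k)) (cube (m + k) 1 - cube k (1 + \<nu>))) w)"
  shows "Brouwer_degree2 M (unit_vector M \<circ> normal_join m k w \<circ> cube_radial (m + k)) \<noteq> 0"
proof -
  let ?Q = "normal_join m k w"
  let ?Y = "cube (m + k) 1 - cube k (1 + \<nu>)"
  have normal: "\<exists>i<m. w y (k + i) \<noteq> 0" if "y \<in> cube_sphere m" for y
    using bd cube_diff_core_iff [OF \<nu>] that by blast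
  have "Brouwer_degree2 M (unit_vector M \<circ> ?Q \<circ> cube_radial (m + k)) = Brouwer_degree2 M (unit_vector M \<circ> ?Q)"
  proof (rule Brouwer_degree2_eq)
    fix x assume "x \<in> topspace (nsphere M)"
    then have "0 < inverse (max_norm (m + k) x)"
      using nsphere_subset_punctured max_norm_punctured Suc by force
    moreover have "cube_radial (m + k) x = (\<lambda>i. inverse (max_norm (m + k) x) * x i)"
      by (simp add: cube_radial_def divide_inverse_commute)
    ultimately show "(unit_vector M \<circ> ?Q \<circ> cube_radial (m + k)) x = (unit_vector M \<circ> ?Q) x"
      by (simp add: normal_join_cmult unit_vector_cmult)
  qed
  also have "\<dots> \<noteq> 0"
  proof (cases m)
    case 0
    then have "Brouwer_degree2 M (unit_vector M \<circ> ?Q) = Brouwer_degree2 M id"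
      by (intro Brouwer_degree2_eq) (simp add: normal_join_def unit_vector_nsphere)
    then show ?thesis
      by simp
  next
    case m: (Suc N)
    have "M = N + k"
      using Suc m by simp
    moreover have "Brouwer_degree2 (N + k) (unit_vector (N + k) \<circ> ?Q) = Brouwer_degree2 N (unit_vector N \<circ> ?Q)"
    proof (rule degree_suspension)
      show "?Q \<in> punctured n \<rightarrow> punctured n" if "m \<le> n" for n
        using normal_join_punctured [OF normal that] .
      show "continuous_on (punctured n) ?Q" for n
        by (rule continuous_on_normal_join [OF w])
    qed (simp_all add: m normal_join_def)
    ultimately have "Brouwer_degree2 M (unit_vector M \<circ> ?Q) = Brouwer_degree2 N (unit_vector N \<circ> ?Q)"
      by (simp only:)
    also have "\<dots> \<noteq> 0"
    proof
      assume deg: "Brouwer_degree2 N (unit_vector N \<circ> ?Q) = 0"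
      let ?last = "\<lambda>(x :: nat \<Rightarrow> real) i. x (k + i)"
      let ?X = "cube_sphere m" and ?S = "topspace (nsphere N)"
      let ?i = "\<lambda>y i. if i < k then 0 else y (i - k) :: real"
      have sub: "?X \<subseteq> topspace (Euclidean_space m)" "?Y \<subseteq> topspace (Euclidean_space (m + k))"
        using cube_sphere_subset_punctured [of m] cube_subset_Euclidean [of "m + k" 1]
        by (auto simp: punctured_def)
      have XC: "?X \<subseteq> cube m 1"
        by (auto simp: cube_sphere_eq cube_eq)
      have last: "?last v \<in> punctured (Suc N)" if "v \<in> ?Y" for v
        using that cube_diff_core_iff [OF \<nu>, of v m k] m
        by (auto simp: punctured_def topspace_Euclidean_space cube_eq fun_eq_iff)
      have last_cont: "continuous_on A ?last" for A
        by (rule continuous_on_coordinatewise_then_product) (rule continuous_on_coordinate)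
      have Y: "continuous_map (top_of_set ?X) (top_of_set ?Y) w"
        using w(1) XC bd by (auto simp: continuous_map_in_subtopology intro: continuous_on_subset)
      have r: "continuous_map (nsphere N) (top_of_set ?X) (cube_radial m)"
      proof -
        have "continuous_map (top_of_set ?S) (top_of_set ?X) (cube_radial m)"
          using nsphere_subset_punctured [of N] cube_radial_in_cube_sphere [of _ m] m
          by (auto simp: continuous_map_in_subtopology intro: continuous_on_subset [OF continuous_on_cube_radial])
        then show ?thesis
          by (simp flip: nsphere_eq)
      qed
      have s: "continuous_map (top_of_set ?X) (nsphere N) (unit_vector N)"
      proof -
        have "continuous_map (top_of_set ?X) (top_of_set ?S) (unit_vector N)"
          using cube_sphere_subset_punctured [of m] unit_vector_in_nsphere [of _ N] m
          by (auto simp: continuous_map_in_subtopology intro: continuous_on_subset [OF continuous_on_unit_vector])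
        then show ?thesis
          by (simp flip: nsphere_eq)
      qed
      have q: "continuous_map (top_of_set ?Y) (nsphere N) (unit_vector N \<circ> ?last)"
      proof -
        have "continuous_on ?Y (unit_vector N \<circ> ?last)"
          by (intro continuous_on_compose last_cont continuous_on_subset [OF continuous_on_unit_vector])
             (use last in blast)
        moreover have "unit_vector N \<circ> ?last \<in> ?Y \<rightarrow> ?S"
          using last unit_vector_in_nsphere by auto
        ultimately have "continuous_map (top_of_set ?Y) (top_of_set ?S) (unit_vector N \<circ> ?last)"
          by (simp only: continuous_map_top_of_set_iff)
        then show ?thesis
          by (simp flip: nsphere_eq)
      qed
      have i_Y: "?i y \<in> ?Y" if y: "y \<in> ?S" for y
      proof -
        have "\<bar>y j\<bar> \<le> 1" for j
          using topspace_nsphere_1 [OF y] by (simp add: abs_square_le_1)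
        moreover have "y j = 0" if "j \<ge> m" for j
          using y that m by (simp add: topspace_nsphere)
        moreover have "\<exists>j<m. y j \<noteq> 0"
          using nsphere_subset_punctured [of N] max_norm_punctured [of y m] max_norm_eq_0_iff [of m y] y m
          by auto
        ultimately show ?thesis
          unfolding cube_diff_core_iff [OF \<nu>] by (auto simp: cube_eq max_norm_le_iff)
      qed
      have i: "continuous_map (nsphere N) (top_of_set ?Y) ?i"
      proof -
        have "continuous_on ?S (\<lambda>y. ?i y j)" for j
          by (cases "j < k") (auto intro: continuous_on_coordinate)
        then have "continuous_map (top_of_set ?S) (top_of_set ?Y) ?i"
          using i_Y by (auto simp: continuous_map_in_subtopology intro: continuous_on_coordinatewise_then_product)
        then show ?thesis
          by (simp flip: nsphere_eq)
      qed
      \<comment> \<open>The last \<open>m\<close> coordinates of the projection of \<open>v\<close> are a positive multiple of those of \<open>v\<close>,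
        and so are those of every point between the two; hence the segment avoids the core.\<close>
      have "homotopic_with_canon (\<lambda>_. True) ?Y ?Y (?i \<circ> (unit_vector N \<circ> ?last)) id"
      proof (rule straight_line_homotopic)
        show "continuous_on ?Y (?i \<circ> (unit_vector N \<circ> ?last))"
          using continuous_map_compose [OF q i] by (simp add: continuous_map_in_subtopology)
        fix v and t :: real
        assume v: "v \<in> ?Y" and t: "0 \<le> t" "t \<le> 1"
        let ?u = "(?i \<circ> (unit_vector N \<circ> ?last)) v"
        have u: "?u \<in> ?Y"
          using i_Y unit_vector_in_nsphere last [OF v] by simp
        define c where "c = inverse (sqrt (\<Sum>j\<le>N. (v (k + j))\<^sup>2))"
        have c: "c > 0"
          using sum_squares_punctured [OF last [OF v]] by (simp add: c_def)
        have u_last: "?u (k + j) = c * v (k + j)" for j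
          by (simp add: unit_vector_def c_def divide_inverse_commute)
        have "\<bar>(1 - t) * ?u j + t * v j\<bar> \<le> 1" if "j < m + k" for j
        proof -
          have "\<bar>?u j\<bar> \<le> 1" "\<bar>v j\<bar> \<le> 1"
            using u v that by (simp_all only: cube_eq max_norm_le_iff mem_Collect_eq Diff_iff zero_le_one)
          then have "(1 - t) * \<bar>?u j\<bar> + t * \<bar>v j\<bar> \<le> 1"
            using t by (intro convex_bound_le) simp_all
          moreover have "\<bar>(1 - t) * ?u j + t * v j\<bar> \<le> \<bar>(1 - t) * ?u j\<bar> + \<bar>t * v j\<bar>"
            by (rule abs_triangle_ineq)
          ultimately show ?thesis
            using t by (simp only: abs_mult abs_of_nonneg diff_ge_0_iff_ge)
        qed
        moreover have "(1 - t) * ?u j + t * v j = 0" if "m + k \<le> j" for j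
          using u v that by (simp only: cube_eq DiffE) (auto simp: cube_eq)
        moreover obtain j where "j < m" "v (k + j) \<noteq> 0"
          using v cube_diff_core_iff [OF \<nu>] by blast
        moreover have "(1 - t) * ?u (k + j) + t * v (k + j) = ((1 - t) * c + t) * v (k + j)"
          unfolding u_last by (simp add: algebra_simps)
        moreover have "(1 - t) * c + t > 0"
          using c t by (cases "t = 1") (auto intro: add_pos_nonneg)
        ultimately show "(\<lambda>j. (1 - t) * ?u j + t * id v j) \<in> ?Y"
          unfolding cube_diff_core_iff [OF \<nu>] id_apply
          by (auto simp: cube_eq max_norm_le_iff simp del: o_apply)
      qed (rule continuous_on_id')
      moreover have "homotopic_with_canon (\<lambda>_. True) ?X ?X (cube_radial m \<circ> unit_vector N) id"
        using cube_radial_unit_vector m by (intro homotopic_with_id2) auto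
      moreover have "Brouwer_degree2 N ((unit_vector N \<circ> ?last) \<circ> w \<circ> cube_radial m) = Brouwer_degree2 N (unit_vector N \<circ> ?Q)"
      proof (rule Brouwer_degree2_eq)
        fix x assume x: "x \<in> ?S"
        have pos: "0 < max_norm m x"
          using x nsphere_subset_punctured m by (auto intro!: max_norm_punctured)
        have "trunc m x = x"
          using x m by (auto simp: trunc_def topspace_nsphere)
        moreover have "cube_radial m x \<in> cube m 1"
          using XC cube_radial_in_cube_sphere [of x m] nsphere_subset_punctured x m by blast
        then have "w (cube_radial m x) \<in> cube (m + k) 1"
          using w(2) by blast
        ultimately have "?Q x = (\<lambda>i. max_norm m x * ?last (w (cube_radial m x)) i)"
          using x m by (auto simp: normal_join_def cube_eq topspace_nsphere)
        then show "((unit_vector N \<circ> ?last) \<circ> w \<circ> cube_radial m) x = (unit_vector N \<circ> ?Q) x"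
          using unit_vector_cmult [OF pos] by simp
      qed
      ultimately have "trivial_homomorphism (reduced_homology_group (int N) (top_of_set ?X))
          (reduced_homology_group (int N) (top_of_set ?Y)) (hom_induced (int N) (top_of_set ?X) {} (top_of_set ?Y) {} w)"
        using trivial_homomorphism_if_degree_0 [OF Y r s _ i q] deg by simp
      then show False
        using hom sub m by (simp add: subtopology_Euclidean_space aug_homology_group_def aug_hom_induced_def)
    qed
    finally show ?thesis .
  qed
  finally show ?thesis .
qed

section \<open>Stability of the intersection in the cube\<close>

text \<open>
Let \<open>a\<close> be close to the inclusion of the core and \<open>b\<close> close to \<open>w\<close>. If their images were disjoint,
the difference of \<open>a\<close> and \<open>b\<close> would be a zero-free map \<open>G\<close> of the product of the two cubes. On the
boundary of the product \<open>G\<close> can be deformed along segments to \<open>normal_join m k w\<close>: where \<open>y\<close> is on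
the boundary the normal part of \<open>w y\<close> is bounded away from \<open>0\<close>, and where \<open>x\<close> is on the boundary of
the core it is at distance at least \<open>\<nu>\<close> from the unit cube. So \<open>normal_join m k w\<close> would have
degree \<open>0\<close>.
\<close>

lemma core_intersection_stable:
  fixes w :: "(nat \<Rightarrow> real) \<Rightarrow> nat \<Rightarrow> real"
  assumes w: "continuous_on (cube m 1) w" "w \<in> cube m 1 \<rightarrow> cube (m + k) 1"
    and bd: "w ` cube_sphere m \<subseteq> cube (m + k) 1 - cube k (1 + \<nu>)"
    and \<nu>: "0 < \<nu>"
    and hom: "\<not> trivial_homomorphism
           (aug_homology_group (int m - 1) (subtopology (Euclidean_space m) (cube_sphere m)))
           (aug_homology_group (int m - 1)
             (subtopology (Euclidean_space (m + k)) (cube (m + k) 1 - cube k (1 + \<nu>))))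
           (aug_hom_induced (int m - 1) (subtopology (Euclidean_space m) (cube_sphere m))
             (subtopology (Euclidean_space (m + k)) (cube (m + k) 1 - cube k (1 + \<nu>))) w)"
  shows "\<exists>\<epsilon>>0. \<forall>a b.
           continuous_on (cube k (1 + \<nu>)) a \<and> a \<in> cube k (1 + \<nu>) \<rightarrow> topspace (Euclidean_space (m + k)) \<and>
           continuous_on (cube m 1) b \<and> b \<in> cube m 1 \<rightarrow> topspace (Euclidean_space (m + k)) \<and>
           (\<forall>x\<in>cube k (1 + \<nu>). max_dist (m + k) x (a x) \<le> \<epsilon>) \<and>
           (\<forall>y\<in>cube m 1. max_dist (m + k) (w y) (b y) \<le> \<epsilon>)
           \<longrightarrow> a ` cube k (1 + \<nu>) \<inter> b ` cube m 1 \<noteq> {}"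
proof -
  have XC: "cube_sphere m \<subseteq> cube m 1"
    by (auto simp: cube_sphere_eq cube_eq)
  have "\<exists>c>0. \<forall>y\<in>cube_sphere m. c \<le> max_norm m (\<lambda>i. w y (k + i))"
  proof (cases "cube_sphere m = {}")
    case False
    have "closed (cube_sphere m)"
      unfolding cube_sphere_def
      by (metis closedin_Euclidean_imp_closed closedin_frontier_of)
    then have "compact (cube_sphere m)"
      using XC compact_cube compact_Int_closed [of "cube m 1" "cube_sphere m"] by (simp add: inf.absorb2)
    moreover have "continuous_on (cube_sphere m) (\<lambda>y. max_norm m (\<lambda>i. w y (k + i)))"
      using continuous_on_product_then_coordinatewise [OF continuous_on_subset [OF w(1) XC]]
      by (intro continuous_on_compose2 [OF continuous_on_max_norm [of UNIV]] continuous_on_coordinatewise_then_product) auto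
    ultimately obtain y where y: "y \<in> cube_sphere m"
      "\<And>y'. y' \<in> cube_sphere m \<Longrightarrow> max_norm m (\<lambda>i. w y (k + i)) \<le> max_norm m (\<lambda>i. w y' (k + i))"
      using continuous_attains_inf [of "cube_sphere m" "\<lambda>y. max_norm m (\<lambda>i. w y (k + i))"] False by blast
    have "\<exists>i<m. w y (k + i) \<noteq> 0"
      using y(1) bd cube_diff_core_iff [of \<nu> "w y" m k] \<nu> by auto
    then have "0 < max_norm m (\<lambda>i. w y (k + i))"
      using max_norm_nonneg [of m "\<lambda>i. w y (k + i)"] max_norm_eq_0_iff [of m "\<lambda>i. w y (k + i)"] by force
    then show ?thesis
      using y by blast
  qed (auto intro: exI [of _ 1])
  then obtain c where c: "c > 0" "\<And>y. y \<in> cube_sphere m \<Longrightarrow> c \<le> max_norm m (\<lambda>i. w y (k + i))"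
    by blast
  \<comment> \<open>A coordinate of \<open>G\<close> differs by at most \<open>2 * \<epsilon>\<close> from its value for unperturbed maps; this has to be
    less than both gaps \<open>c\<close> and \<open>\<nu>\<close>.\<close>
  define \<epsilon> where "\<epsilon> = min c \<nu> / 3"
  have \<epsilon>: "0 < \<epsilon>" "2 * \<epsilon> < c" "2 * \<epsilon> < \<nu>"
    using c(1) \<nu> by (auto simp: \<epsilon>_def)
  have "a ` cube k (1 + \<nu>) \<inter> b ` cube m 1 \<noteq> {}"
    if a: "continuous_on (cube k (1 + \<nu>)) a" "a \<in> cube k (1 + \<nu>) \<rightarrow> topspace (Euclidean_space (m + k))"
      and b: "continuous_on (cube m 1) b" "b \<in> cube m 1 \<rightarrow> topspace (Euclidean_space (m + k))"
      and a_close: "\<And>x. x \<in> cube k (1 + \<nu>) \<Longrightarrow> max_dist (m + k) x (a x) \<le> \<epsilon>"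
      and b_close: "\<And>y. y \<in> cube m 1 \<Longrightarrow> max_dist (m + k) (w y) (b y) \<le> \<epsilon>" for a b
  proof
    assume disjoint: "a ` cube k (1 + \<nu>) \<inter> b ` cube m 1 = {}"
    define n where "n = m + k"
    \<comment> \<open>The product is parametrised by \<open>cube n 1\<close>: \<open>trunc m z\<close> is the point \<open>y\<close>, and \<open>X z\<close> is the point of
      the core, stretched by \<open>1 + \<nu>\<close>. \<open>G z\<close> is \<open>b - a\<close> in the normal coordinates and \<open>a - b\<close> in the others,
      which are the signs of the normal part of \<open>w\<close> and of \<open>x\<close>.\<close>
    define X where "X z = (\<lambda>i. if i < k then (1 + \<nu>) * z (m + i) else 0)" for z :: "nat \<Rightarrow> real"
    define G where "G z = (\<lambda>i. if i < m then b (trunc m z) (k + i) - a (X z) (k + i)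
        else if i < n then a (X z) (i - m) - b (trunc m z) (i - m) else 0)" for z
    let ?C = "cube n 1"
    have X: "X z \<in> cube k (1 + \<nu>)" if "z \<in> ?C" for z
    proof -
      have "\<bar>z (m + i)\<bar> \<le> 1" if "i < k" for i
        using that \<open>z \<in> ?C\<close> by (simp add: cube_eq max_norm_le_iff n_def)
      then show ?thesis
        using \<nu> by (simp add: cube_eq max_norm_le_iff X_def abs_mult mult_left_le)
    qed
    have Y: "trunc m z \<in> cube m 1" if "z \<in> ?C" for z
      using that by (simp add: cube_eq max_norm_le_iff n_def) (simp add: trunc_def)
    have "continuous_on ?C X"
    proof -
      have "continuous_on ?C (\<lambda>z. X z i)" for i
        by (cases "i < k") (auto simp: X_def intro!: continuous_intros)
      then show ?thesis
        by (rule continuous_on_coordinatewise_then_product)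
    qed
    then have aX: "continuous_on ?C (\<lambda>z. a (X z) i)" for i
      using X by (intro continuous_on_compose2 [OF continuous_on_product_then_coordinatewise [OF a(1)]]) auto
    have "continuous_on ?C (trunc m)"
    proof -
      have "continuous_on ?C (\<lambda>z. trunc m z i)" for i
        by (cases "i < m") (auto simp: trunc_def intro!: continuous_intros)
      then show ?thesis
        by (rule continuous_on_coordinatewise_then_product)
    qed
    then have bY: "continuous_on ?C (\<lambda>z. b (trunc m z) i)" for i
      using Y by (intro continuous_on_compose2 [OF continuous_on_product_then_coordinatewise [OF b(1)]]) auto
    have contG: "continuous_on ?C G"
    proof -
      have "continuous_on ?C (\<lambda>z. G z i)" for i
        by (cases "i < m"; cases "i < n") (auto simp: G_def intro!: continuous_on_diff aX bY)
      then show ?thesis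
        by (rule continuous_on_coordinatewise_then_product)
    qed
    have G: "G z \<in> punctured n" if z: "z \<in> ?C" for z
    proof -
      have in_E: "a (X z) i = 0" "b (trunc m z) i = 0" if "n \<le> i" for i
        using a(2) b(2) X [OF z] Y [OF z] that by (auto simp: topspace_Euclidean_space n_def)
      have "a (X z) \<noteq> b (trunc m z)"
        using disjoint X [OF z] Y [OF z] by blast
      then obtain i where i: "a (X z) i \<noteq> b (trunc m z) i"
        by blast
      then have "i < n"
        using in_E by (metis not_le)
      have "\<exists>j. G z j \<noteq> 0"
      proof (cases "i < k")
        case True
        then show ?thesis
          using i by (intro exI [of _ "m + i"]) (simp add: G_def n_def)
      next
        case False
        then show ?thesis
          using i \<open>i < n\<close> by (intro exI [of _ "i - k"]) (auto simp: G_def n_def)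
      qed
      then have "G z \<noteq> (\<lambda>i. 0)"
        by auto
      then show ?thesis
        by (simp add: punctured_def topspace_Euclidean_space) (simp add: G_def n_def)
    qed
    show False
    proof (cases n)
      case 0
      \<comment> \<open>Punctured \<open>\<real>\<^sup>0\<close> is empty.\<close>
      then show False
        using G [of "\<lambda>i. 0"] by (auto simp: punctured_def topspace_Euclidean_space cube_eq)
    next
      case (Suc M)
      have a_close: "\<bar>X z i - a (X z) i\<bar> \<le> \<epsilon>" "\<bar>w (trunc m z) i - b (trunc m z) i\<bar> \<le> \<epsilon>"
        if "z \<in> ?C" "i < n" for z i
        using a_close [OF X] b_close [OF Y] that \<epsilon>(1) by (auto simp: max_dist_le_iff n_def)
      have "Brouwer_degree2 M (unit_vector M \<circ> normal_join m k w \<circ> cube_radial (Suc M)) = 0"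
      proof (rule degree_eq_0_if_extends)
        show "continuous_on (cube (Suc M) 1) G" "G \<in> cube (Suc M) 1 \<rightarrow> punctured (Suc M)"
          using contG G Suc by auto
        show "continuous_on (cube_sphere (Suc M)) (normal_join m k w)"
          by (rule continuous_on_normal_join [OF w])
        fix z and t :: real
        assume z: "z \<in> cube_sphere (Suc M)" and t: "0 \<le> t" "t \<le> 1"
        have z0: "\<And>i. n \<le> i \<Longrightarrow> z i = 0" and z1: "max_norm n z = 1"
          using z Suc by (auto simp: cube_sphere_eq)
        then have zC: "z \<in> ?C"
          by (simp add: cube_eq)
        let ?H = "\<lambda>i. (1 - t) * G z i + t * normal_join m k w z i"
        have "\<exists>i. ?H i \<noteq> 0"
        proof (cases "max_norm m z = 1")
          case True
          \<comment> \<open>Here \<open>y\<close> is on the boundary, and the largest normal coordinate of \<open>w y\<close> stays non-zero.\<close>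
          let ?y = "trunc m z"
          have y: "?y \<in> cube_sphere m"
            using True by (simp add: cube_sphere_eq) (simp add: trunc_def)
          have "max_norm m (\<lambda>i. w ?y (k + i)) \<noteq> 0"
            using c(1) c(2) [OF y] by linarith
          then obtain i where i: "i < m" "\<bar>w ?y (k + i)\<bar> = max_norm m (\<lambda>i. w ?y (k + i))"
            using max_norm_attained by blast
          have 1: "normal_join m k w z i = w ?y (k + i)"
            using i(1) True by (simp add: normal_join_def cube_radial_def)
          have "\<bar>G z i - w ?y (k + i)\<bar> \<le> 2 * \<epsilon>"
            using a_close [OF zC, of "k + i"] i(1) by (simp add: G_def X_def n_def)
          then have "\<bar>(1 - t) * (G z i - w ?y (k + i))\<bar> \<le> 1 * (2 * \<epsilon>)"
            unfolding abs_mult using t by (intro mult_mono) auto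
          moreover have "?H i = (1 - t) * (G z i - w ?y (k + i)) + w ?y (k + i)"
            unfolding 1 by (simp add: algebra_simps)
          moreover have "2 * \<epsilon> < \<bar>w ?y (k + i)\<bar>"
            using i(2) c(2) [OF y] \<epsilon>(2) by linarith
          ultimately have "?H i \<noteq> 0"
            by linarith
          then show ?thesis ..
        next
          case False
          \<comment> \<open>Here \<open>x\<close> is on the boundary, and its extremal coordinate \<open>j\<close> keeps its sign.\<close>
          obtain j where j: "j < n" "\<bar>z j\<bar> = 1"
            using max_norm_attained [of n z] z1 by auto
          have "m \<le> j"
          proof (rule ccontr)
            assume "\<not> m \<le> j"
            then have "1 \<le> max_norm m z"
              using abs_le_max_norm [of j m z] j by simp
            moreover have "max_norm m z \<le> max_norm n z"
              using abs_le_max_norm [of _ n z] by (simp add: max_norm_le_iff max_norm_nonneg n_def)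
            ultimately show False
              using False z1 by simp
          qed
          define i where "i = j - m"
          have i: "j = m + i" "i < k"
            using \<open>m \<le> j\<close> j(1) by (auto simp: i_def n_def)
          have join: "normal_join m k w z j = z j" and Gj: "G z j = a (X z) i - b (trunc m z) i"
            and Xi: "X z i = (1 + \<nu>) * z j"
            using i by (simp_all add: normal_join_def G_def X_def n_def)
          have "w (trunc m z) \<in> cube (m + k) 1"
            using Y [OF zC] w(2) by blast
          then have w1: "\<bar>w (trunc m z) i\<bar> \<le> 1"
            using i by (simp add: cube_eq max_norm_le_iff)
          have close: "\<bar>(1 + \<nu>) * z j - a (X z) i\<bar> \<le> \<epsilon>" "\<bar>w (trunc m z) i - b (trunc m z) i\<bar> \<le> \<epsilon>"
            using a_close [OF zC, of i] i Xi by (simp_all add: n_def)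
          have "0 < z j * G z j"
            using j(2) close w1 \<epsilon>(3) unfolding Gj by (auto simp: abs_if split: if_split_asm)
          moreover have "z j * ?H j = (1 - t) * (z j * G z j) + t * (z j * z j)"
            unfolding join by (simp add: algebra_simps)
          moreover have "z j * z j = 1"
            using j(2) by (metis abs_mult_self_eq mult_1)
          ultimately have "0 < z j * ?H j"
            using t by (cases "t = 0") (auto intro: add_nonneg_pos)
          then have "?H j \<noteq> 0"
            by auto
          then show ?thesis ..
        qed
        moreover have "?H i = 0" if "n \<le> i" for i
          using that z0 [OF that] by (simp add: G_def normal_join_def n_def)
        ultimately show "?H \<in> punctured (Suc M)"
          using Suc by (auto simp: punctured_def topspace_Euclidean_space fun_eq_iff)
      qed
      then show False
        using degree_normal_join_nonzero [OF w bd _ _ hom, of M] \<nu> Suc by (simp add: n_def)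
    qed
  qed
  then show ?thesis
    using \<epsilon>(1) by (intro exI [of _ \<epsilon>]) blast
qed

section \<open>Perturbations in a chart\<close>

lemma tendsto_coordinates:
  fixes l :: "nat \<Rightarrow> real"
  shows "(f \<longlongrightarrow> l) F \<longleftrightarrow> (\<forall>i. ((\<lambda>x. f x i) \<longlongrightarrow> l i) F)"
  using limitin_componentwise [of "\<lambda>_. euclideanreal" UNIV f l F]
  by (simp add: euclidean_product_topology)

text \<open>
The points within \<open>\<delta>\<close> of a compact subset of an open set stay in the open set, and a continuous map
moves them little. The compactness argument is by sequences: a family of counterexamples would
have a subsequence along which both points converge to the same point of \<open>K\<close>.
\<close>

lemma uniformly_close_near_compact:
  fixes \<phi> :: "(nat \<Rightarrow> real) \<Rightarrow> nat \<Rightarrow> real"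
  assumes U: "openin (Euclidean_space n) U" and \<phi>: "continuous_on U \<phi>"
    and K: "compact K" "K \<subseteq> U" and e: "0 < e"
  shows "\<exists>\<delta>>0. \<forall>x\<in>K. \<forall>y\<in>topspace (Euclidean_space n).
           max_dist n x y \<le> \<delta> \<longrightarrow> y \<in> U \<and> max_dist n (\<phi> x) (\<phi> y) \<le> e"
proof (rule ccontr)
  assume contra: "\<not> ?thesis"
  have "\<exists>x y. x \<in> K \<and> y \<in> topspace (Euclidean_space n) \<and> max_dist n x y \<le> inverse (real (Suc r)) \<and>
      \<not> (y \<in> U \<and> max_dist n (\<phi> x) (\<phi> y) \<le> e)" for r
    using contra by (auto simp del: of_nat_Suc dest!: spec [of _ "inverse (real (Suc r))"])
  then obtain x y where x: "\<And>r. x r \<in> K" and y: "\<And>r. y r \<in> topspace (Euclidean_space n)"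
    and xy: "\<And>r. max_dist n (x r) (y r) \<le> inverse (real (Suc r))"
    and bad: "\<And>r. \<not> (y r \<in> U \<and> max_dist n (\<phi> (x r)) (\<phi> (y r)) \<le> e)"
    by metis
  obtain l s where l: "l \<in> K" "strict_mono s" "(x \<circ> s) \<longlonglongrightarrow> l"
    using K(1) x by (meson compact_imp_seq_compact seq_compactE)
  obtain W where W: "open W" "U = topspace (Euclidean_space n) \<inter> W"
    using U by (auto simp: Euclidean_space_eq openin_open)
  have "(\<lambda>r. x (s r) i - y (s r) i) \<longlonglongrightarrow> 0" for i
  proof (rule Lim_null_comparison)
    have "\<bar>x (s r) i - y (s r) i\<bar> \<le> inverse (real (Suc (s r)))" for r
    proof (cases "i < n")
      case True
      then show ?thesis
        using xy [of "s r"] by (simp add: max_dist_le_iff)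
    next
      case False
      then show ?thesis
        using x [of "s r"] y [of "s r"] K(2) W by (auto simp: topspace_Euclidean_space)
    qed
    then show "\<forall>\<^sub>F r in sequentially. norm (x (s r) i - y (s r) i) \<le> inverse (real (Suc (s r)))"
      by (simp del: of_nat_Suc)
    show "(\<lambda>r. inverse (real (Suc (s r)))) \<longlonglongrightarrow> 0"
      using LIMSEQ_subseq_LIMSEQ [OF LIMSEQ_inverse_real_of_nat l(2)] by (simp add: o_def)
  qed
  then have "(\<lambda>r. x (s r) i - (x (s r) i - y (s r) i)) \<longlonglongrightarrow> l i - 0" for i
    using l(3) by (intro tendsto_diff) (auto simp: tendsto_coordinates o_def)
  then have yl: "(\<lambda>r. y (s r)) \<longlonglongrightarrow> l"
    by (simp add: tendsto_coordinates)
  moreover have "l \<in> W"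
    using l(1) K(2) W by blast
  ultimately have yU: "\<forall>\<^sub>F r in sequentially. y (s r) \<in> U"
    using topological_tendstoD [OF yl W(1)] y W(2) by auto
  have lU: "l \<in> U"
    using l(1) K(2) by blast
  have "(\<lambda>r. \<phi> (x (s r))) \<longlonglongrightarrow> \<phi> l"
    using l(3) x K(2) by (intro continuous_on_tendsto_compose [OF \<phi> _ lU] always_eventually) (auto simp: o_def)
  moreover have "(\<lambda>r. \<phi> (y (s r))) \<longlonglongrightarrow> \<phi> l"
    by (rule continuous_on_tendsto_compose [OF \<phi> yl lU yU])
  ultimately have "(\<lambda>r. \<phi> (x (s r)) i - \<phi> (y (s r)) i) \<longlonglongrightarrow> \<phi> l i - \<phi> l i" for i
    by (intro tendsto_diff) (auto simp: tendsto_coordinates)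
  then have "\<forall>\<^sub>F r in sequentially. dist (\<phi> (x (s r)) i - \<phi> (y (s r)) i) 0 < e" for i
    by (intro tendstoD e) simp
  then have "\<forall>\<^sub>F r in sequentially. \<forall>i\<in>{..<n}. \<bar>\<phi> (x (s r)) i - \<phi> (y (s r)) i\<bar> < e"
    by (intro eventually_ball_finite) (auto simp: dist_real_def)
  then have "\<forall>\<^sub>F r in sequentially. y (s r) \<in> U \<and> max_dist n (\<phi> (x (s r))) (\<phi> (y (s r))) \<le> e"
    using yU by eventually_elim (use e in \<open>auto simp: max_dist_le_iff less_imp_le\<close>)
  then show False
    using bad by (auto simp: eventually_sequentially)
qed

text \<open>
Neighbourhoods may fail to be open, but a set homeomorphic to Euclidean space of the same
dimension is open by invariance of domain.
\<close>

lemma chart_domain_open: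
  assumes "homeomorphic_map (subtopology (Euclidean_space n) U) (Euclidean_space n) \<phi>"
    and "U \<subseteq> topspace (Euclidean_space n)"
  shows "openin (Euclidean_space n) U"
proof -
  obtain \<psi> where "homeomorphic_maps (subtopology (Euclidean_space n) U) (Euclidean_space n) \<phi> \<psi>"
    using assms(1) by (auto simp: homeomorphic_map_maps)
  then have \<psi>: "homeomorphic_map (Euclidean_space n) (subtopology (Euclidean_space n) U) \<psi>"
    using homeomorphic_maps_map by blast
  then have "\<psi> ` topspace (Euclidean_space n) = U"
    using homeomorphic_imp_surjective_map assms(2) by fastforce
  moreover have "openin (Euclidean_space n) (\<psi> ` topspace (Euclidean_space n))"
    using homeomorphic_imp_continuous_map [OF \<psi>] homeomorphic_imp_injective_map [OF \<psi>]
    by (intro invariance_of_domain_Euclidean_space) (auto simp: continuous_map_in_subtopology)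
  ultimately show ?thesis
    by simp
qed

lemma C0_dist_leD:
  assumes "C0_dist n X f g \<le> ennreal \<delta>" "0 < \<delta>" "x \<in> topspace X"
  shows "max_dist n (f x) (g x) \<le> \<delta>"
proof -
  have "ennreal (max_dist n (f x) (g x)) \<le> ennreal \<delta>"
    using assms(1,3) by (auto simp: C0_dist_def SUP_le_iff)
  then show ?thesis
    using assms(2) by simp
qed

theorem proposition2:
  fixes n k l :: nat
    and A B U V\<^sub>A V\<^sub>B J J\<^sub>A :: "(nat \<Rightarrow> real) set"
    and p :: "nat \<Rightarrow> real"
    and \<phi> f :: "(nat \<Rightarrow> real) \<Rightarrow> nat \<Rightarrow> real"
    and \<nu> :: real
  assumes "topological_submanifold n k A"
    and "topological_submanifold n l B"
    and "p \<in> A \<inter> B"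
    and "neighbourhood (Euclidean_space n) p U"
    and "homeomorphic_map (subtopology (Euclidean_space n) U) (Euclidean_space n) \<phi>"
    and "\<phi> p = (\<lambda>i. 0)"
    and "\<phi> ` (A \<inter> U) = topspace (Euclidean_space k)"
    and "neighbourhood (subtopology (Euclidean_space n) A) p V\<^sub>A"
    and "neighbourhood (subtopology (Euclidean_space n) B) p V\<^sub>B"
    and "(Euclidean_space n) closure_of V\<^sub>A \<subseteq> U"
    and "(Euclidean_space n) closure_of V\<^sub>B \<subseteq> U"
    and "\<nu> > 0"
    and "J = cube n 1"
    and "J\<^sub>A = cube k (1 + \<nu>)"
    and "J\<^sub>A \<subseteq> \<phi> ` V\<^sub>A"
    and "continuous_map (subtopology (Euclidean_space (n - k)) (cube (n - k) 1))
           (subtopology (Euclidean_space n) V\<^sub>B) f"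
    and "\<phi> ` f ` cube (n - k) 1 \<subseteq> J"
    and "\<phi> ` f ` cube_sphere (n - k) \<subseteq> J - J\<^sub>A"
    and "\<not> trivial_homomorphism
           (aug_homology_group (int n - int k - 1)
             (subtopology (Euclidean_space (n - k)) (cube_sphere (n - k))))
           (aug_homology_group (int n - int k - 1)
             (subtopology (Euclidean_space n) (J - J\<^sub>A)))
           (aug_hom_induced (int n - int k - 1)
             (subtopology (Euclidean_space (n - k)) (cube_sphere (n - k)))
             (subtopology (Euclidean_space n) (J - J\<^sub>A))
             (\<phi> \<circ> f))"
  shows "\<exists>\<delta>>0. essential_intersection n \<delta>
           (subtopology (Euclidean_space n) A) (subtopology (Euclidean_space n) B)
           (\<lambda>x. x) (\<lambda>x. x) V\<^sub>A V\<^sub>B"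
proof -
  let ?E = "topspace (Euclidean_space n)"
  define m where "m = n - k"
  have n: "n = m + k"
    using assms(1) by (simp add: m_def topological_submanifold_def)
  then have degree: "int n - int k - 1 = int m - 1"
    by simp
  have U: "U \<subseteq> ?E"
    using assms(4) by (simp add: neighbourhood_def)
  have VA: "V\<^sub>A \<subseteq> ?E \<inter> A" and VB: "V\<^sub>B \<subseteq> ?E \<inter> B"
    using assms(8,9) by (simp_all add: neighbourhood_def)
  have VU: "V\<^sub>A \<subseteq> U" "V\<^sub>B \<subseteq> U"
    using assms(10,11) VA VB closure_of_subset [of V\<^sub>A "Euclidean_space n"]
      closure_of_subset [of V\<^sub>B "Euclidean_space n"] by auto
  obtain \<psi> where \<phi>\<psi>_maps: "homeomorphic_maps (subtopology (Euclidean_space n) U) (Euclidean_space n) \<phi> \<psi>"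
    using assms(5) by (auto simp: homeomorphic_map_maps)
  have \<phi>: "continuous_on U \<phi>" "\<phi> \<in> U \<rightarrow> ?E"
    using \<phi>\<psi>_maps continuous_map_Euclidean_subspace_iff [OF U] by (auto simp: homeomorphic_maps_def)
  have "continuous_map (Euclidean_space n) (Euclidean_space n) \<psi>"
    using \<phi>\<psi>_maps by (simp add: homeomorphic_maps_def continuous_map_in_subtopology)
  then have \<psi>: "continuous_on ?E \<psi>"
    using continuous_map_Euclidean_subspace_iff [of ?E n n \<psi>] by simp
  have \<psi>\<phi>: "\<psi> (\<phi> x) = x" if "x \<in> U" for x
    using \<phi>\<psi>_maps U that by (auto simp: homeomorphic_maps_def)
  have JA: "J\<^sub>A \<subseteq> ?E"
    unfolding assms(14) by (rule subset_trans [OF cube_subset_Euclidean]) (simp add: n)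
  have \<psi>_VA: "\<psi> x \<in> V\<^sub>A" and \<phi>\<psi>: "\<phi> (\<psi> x) = x" if x: "x \<in> J\<^sub>A" for x
  proof -
    obtain v where v: "v \<in> V\<^sub>A" "x = \<phi> v"
      using x assms(15) by blast
    then have "\<psi> x = v"
      using \<psi>\<phi> VU(1) by blast
    then show "\<psi> x \<in> V\<^sub>A" "\<phi> (\<psi> x) = x"
      using v by simp_all
  qed
  let ?D = "cube m 1"
  have f: "continuous_on ?D f" "f \<in> ?D \<rightarrow> V\<^sub>B"
    using assms(16) VB unfolding m_def [symmetric]
    by (auto simp: continuous_map_in_subtopology continuous_map_Euclidean_subspace_iff [OF cube_subset_Euclidean]
        inf.absorb2 [OF cube_subset_Euclidean])
  define w where "w = \<phi> \<circ> f"
  have w: "continuous_on ?D w" "w \<in> ?D \<rightarrow> cube (m + k) 1"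
  proof -
    show "continuous_on ?D w"
      unfolding w_def o_def by (rule continuous_on_compose2 [OF \<phi>(1) f(1)]) (use f(2) VU(2) in blast)
    show "w \<in> ?D \<rightarrow> cube (m + k) 1"
      using assms(13,17) by (auto simp: w_def m_def [symmetric] n [symmetric])
  qed
  have bd: "w ` cube_sphere m \<subseteq> cube (m + k) 1 - cube k (1 + \<nu>)"
    using assms(13,14,18) by (simp add: w_def image_comp m_def [symmetric] n [symmetric])
  obtain \<epsilon> where \<epsilon>: "\<epsilon> > 0" and meets: "\<And>a b. \<lbrakk>continuous_on J\<^sub>A a; a \<in> J\<^sub>A \<rightarrow> ?E;
      continuous_on ?D b; b \<in> ?D \<rightarrow> ?E; \<forall>x\<in>J\<^sub>A. max_dist n x (a x) \<le> \<epsilon>;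
      \<forall>y\<in>?D. max_dist n (w y) (b y) \<le> \<epsilon>\<rbrakk> \<Longrightarrow> a ` J\<^sub>A \<inter> b ` ?D \<noteq> {}"
    using core_intersection_stable [OF w bd assms(12)] assms(19)
    unfolding degree assms(13,14) m_def [symmetric] n [symmetric] w_def by blast
  let ?K = "\<psi> ` J\<^sub>A \<union> f ` ?D"
  have "compact ?K"
    using f(1) compact_cube continuous_on_subset [OF \<psi> JA] unfolding assms(14)
    by (intro compact_Un compact_continuous_image)
  moreover have KU: "?K \<subseteq> U"
    using \<psi>_VA f(2) VU by auto
  ultimately obtain \<delta> where \<delta>: "\<delta> > 0" and close: "\<And>x y. \<lbrakk>x \<in> ?K; y \<in> ?E; max_dist n x y \<le> \<delta>\<rbrakk>
      \<Longrightarrow> y \<in> U \<and> max_dist n (\<phi> x) (\<phi> y) \<le> \<epsilon>"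
    using uniformly_close_near_compact [OF chart_domain_open [OF assms(5) U] \<phi>(1) _ _ \<epsilon>] by metis
  have "essential_intersection n \<delta> (subtopology (Euclidean_space n) A) (subtopology (Euclidean_space n) B)
           (\<lambda>x. x) (\<lambda>x. x) V\<^sub>A V\<^sub>B"
    unfolding essential_intersection_def
  proof (intro allI impI, elim conjE)
    fix g1 g2
    assume g1: "continuous_map (subtopology (Euclidean_space n) A) (Euclidean_space n) g1"
      and g2: "continuous_map (subtopology (Euclidean_space n) B) (Euclidean_space n) g2"
      and d1: "C0_dist n (subtopology (Euclidean_space n) A) (\<lambda>x. x) g1 \<le> ennreal \<delta>"
      and d2: "C0_dist n (subtopology (Euclidean_space n) B) (\<lambda>x. x) g2 \<le> ennreal \<delta>"
    have g1': "continuous_on V\<^sub>A g1" "g1 \<in> V\<^sub>A \<rightarrow> ?E" and g2': "continuous_on V\<^sub>B g2" "g2 \<in> V\<^sub>B \<rightarrow> ?E"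
      using continuous_map_from_subtopology_mono [OF g1, of V\<^sub>A] continuous_map_from_subtopology_mono [OF g2, of V\<^sub>B] VA VB
    by (simp_all add: continuous_map_Euclidean_subspace_iff)
    have A: "g1 (\<psi> x) \<in> U \<and> max_dist n x (\<phi> (g1 (\<psi> x))) \<le> \<epsilon>" if x: "x \<in> J\<^sub>A" for x
      using close [of "\<psi> x" "g1 (\<psi> x)"] C0_dist_leD [OF d1 \<delta>, of "\<psi> x"] \<psi>_VA [OF x] x VA g1'(2) \<phi>\<psi> [OF x]
      by auto
    have B: "g2 (f y) \<in> U \<and> max_dist n (w y) (\<phi> (g2 (f y))) \<le> \<epsilon>" if y: "y \<in> ?D" for y
    proof -
      have "f y \<in> V\<^sub>B"
        using f(2) y by blast
      then show ?thesis
        using close [of "f y" "g2 (f y)"] C0_dist_leD [OF d2 \<delta>, of "f y"] y VB g2'(2)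
        by (auto simp: w_def)
    qed
    have "continuous_on J\<^sub>A (\<lambda>x. \<phi> (g1 (\<psi> x)))"
      using A \<psi>_VA
      by (intro continuous_on_compose2 [OF \<phi>(1)] continuous_on_compose2 [OF g1'(1)] continuous_on_subset [OF \<psi> JA]) auto
    moreover have "continuous_on ?D (\<lambda>y. \<phi> (g2 (f y)))"
      using B f by (intro continuous_on_compose2 [OF \<phi>(1)] continuous_on_compose2 [OF g2'(1)]) auto
    ultimately have "(\<lambda>x. \<phi> (g1 (\<psi> x))) ` J\<^sub>A \<inter> (\<lambda>y. \<phi> (g2 (f y))) ` ?D \<noteq> {}"
      using A B \<phi>(2) by (intro meets) auto
    then obtain x y where xy: "x \<in> J\<^sub>A" "y \<in> ?D" "\<phi> (g1 (\<psi> x)) = \<phi> (g2 (f y))"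
      by auto
    then have "g1 (\<psi> x) = g2 (f y)"
      using A B \<psi>\<phi> by metis
    then show "g1 ` V\<^sub>A \<inter> g2 ` V\<^sub>B \<noteq> {}"
      using \<psi>_VA [OF xy(1)] f(2) xy(2) by blast
  qed
  then show ?thesis
    using \<delta> by blast
qed

end
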